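(* Let $H$ and $G$ be two locally compact second countable compactly generated unimodular groups. Let $\varphi\colon(0,\infty)\to(0,\infty)$ be a function such that $\varphi$ and $t\mapsto \frac{t}{\varphi(t)}$ are non-decreasing. Suppose there exists a $\varphi$-measure subgroup coupling from $H$ to $G$ that is coarsely $m$-to-$1$ (for some $m>0$). Then $$\varphi\circ j_{1,G}\preccurlyeq j_{1,H}.$$
   Context: Conventions. Fix compact symmetric generating subsets $S_H\subset H$, $S_G\subset G$, with word lengths $|\cdot|_H,|\cdot|_G$, and left-invariant proper metrics $d_H,d_G$ compatible with the topologies and quasi-isometric to the word metrics. Haar measures $\lambda_H,\lambda_G$ are fixed. A scale $s>0$ is fixed once and for all. Conventions: $\varphi(0)=0$ and $\varphi(+\infty)=\lim_{t\to\infty}\varphi(t)$. Smooth actions. A measurable space is countably separated if there is a countable family of measurable sets separating its points. A Borel action of a locally compact second countable group on a standard Borel space $\Omega$ is smooth if the quotient, with the quotient measurable structure, is countably separated; then there is a Borel section of the quotient map, whose image is called a fundamental domain. Measure subgroup coupling. A measure subgroup coupling from $H$ to $G$ is a standard Borel space $\Omega$ with a nonzero measure $\mu$ and two commuting, smooth, free, $\mu$-preserving Borel actions of $H$ and $G$ (both denoted $*$) with fundamental domains $\mathcal F_H,\mathcal F_G$, such that there exist a $\sigma$-finite measure $\nu_H$ on $\mathcal F_H$ and a finite measure $\nu_G$ on $\mathcal F_G$ for which the maps $i_G\colon (G\times\mathcal F_G,\lambda_G\otimes\nu_G)\to(\Omega,\mu)$, $(g,x)\mapsto g*x$, and $i_H\colon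 (H\times\mathcal F_H,\lambda_H\otimes\nu_H)\to(\Omega,\mu)$, $(h,x)\mapsto h*x$, are isomorphisms of measured spaces. Cocycle. For $h\in H$, $x\in\mathcal F_G$, let $h\cdot x\in\mathcal F_G$ be the unique point of $\mathcal F_G$ in the $G$-orbit of $h*x$, and let $c_G(h,x)\in G$ be defined by $h*x=c_G(h,x)*(h\cdot x)$. The coupling is a $\varphi$-measure subgroup coupling if $\sup_{h\in S_H}\int_{\mathcal F_G}\varphi(|c_G(h,x)|_G)\,d\nu_G(x)<\infty$. It is coarsely $m$-to-$1$ if for every $x\in\mathcal F_G$ the map $c_x\colon H\to G$, $c_x(h)=c_G(h^{-1},x)$, is such that the preimage of any ball of radius $3$ in $G$ can be covered by at most $m$ balls of radius $s$ in $H$. Isoperimetric profile. For $f\in L^1(G,\lambda_G)$ put $\|\nabla_G^r f\|_1=\sup_{t\in S_G}\|f-\rho(t)f\|_1$, where $(\rho(t)f)(g)=f(gt)$. For $A\subset G$ of finite measure, $J_{1,G}(A)=\sup\|f\|_1/\|\nabla_G^r f\|_1\in[0,+\infty]$, the supremum being over nonzero $f\in L^1(G)$ vanishing outside $A$ (ratio $+\infty$ if the gradient vanishes), and $j_{1,G}(v)=\sup_{\lambda_G(A)\le v}J_{1,G}(A)$. (Since $G$ is unimodular, the left regular representation gives the same profile.) Similarly for $H$. For nondecreasing functions $a,b$, $a\preccurlyeq b$ means there is $C>0$ with $a(v)=O(b(Cv))$ as $v\to\infty$. *)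

theory Defs
  imports "HOL-Analysis.Analysis"
begin

text \<open>
  Groups are written additively, because the library's class of topological groups
  \<^class>\<open>topological_group_add\<close> is additive; it does not assume commutativity.
  Thus \<open>g + h\<close>, \<open>0\<close>, \<open>- g\<close> stand for the product, the identity and the inverse.
  Quantities in \<open>[0,+\<infinity>]\<close> have type \<^typ>\<open>ennreal\<close>, so suprema of empty families are \<open>0\<close>.
\<close>

section \<open>Groups, word lengths, metrics, Haar measures\<close>

definition compact_symmetric_generating :: "'a::topological_group_add set \<Rightarrow> bool" where
  "compact_symmetric_generating S \<longleftrightarrow>
     compact S \<and> uminus ` S = S \<and> (\<forall>g. \<exists>xs. set xs \<subseteq> S \<and> sum_list xs = g)"

definition word_length :: "'a::group_add set \<Rightarrow> 'a \<Rightarrow> nat" where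
  "word_length S g = (LEAST n. \<exists>xs. length xs = n \<and> set xs \<subseteq> S \<and> sum_list xs = g)"

definition left_invariant_metric :: "('a::group_add \<Rightarrow> 'a \<Rightarrow> real) \<Rightarrow> bool" where
  "left_invariant_metric d \<longleftrightarrow> (\<forall>g x y. d (g + x) (g + y) = d x y)"

text \<open>
  Properness means that closed balls are compact. The word metric is
  \<open>(x, y) \<mapsto> |x\<inverse> y|\<close>, and the last clause says that the identity map is a
  quasi-isometry between the two metrics.
\<close>

definition admissible_metric ::
    "'a::topological_group_add set \<Rightarrow> ('a \<Rightarrow> 'a \<Rightarrow> real) \<Rightarrow> bool" where
  "admissible_metric S d \<longleftrightarrow>
     Metric_space UNIV d \<and>
     Metric_space.mtopology UNIV d = euclidean \<and>
     left_invariant_metric d \<and>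
     (\<forall>x r. compact (Metric_space.mcball UNIV d x r)) \<and>
     (\<exists>a\<ge>1. \<exists>b\<ge>0. \<forall>x y.
        real (word_length S (- x + y)) / a - b \<le> d x y \<and>
        d x y \<le> a * real (word_length S (- x + y)) + b)"

text \<open>
  On a second countable locally compact group, Borel measures that are finite on compact
  sets are automatically regular, so regularity is not listed.
\<close>

definition left_haar_measure :: "'a::topological_group_add measure \<Rightarrow> bool" where
  "left_haar_measure L \<longleftrightarrow>
     sets L = sets borel \<and>
     emeasure L UNIV \<noteq> 0 \<and>
     (\<forall>K. compact K \<longrightarrow> emeasure L K < \<infinity>) \<and>
     (\<forall>g. distr L borel (\<lambda>x. g + x) = L)"

definition unimodular :: "'a::topological_group_add itself \<Rightarrow> bool" where
  "unimodular _ \<longleftrightarrow>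
     (\<forall>L :: 'a measure. left_haar_measure L \<longrightarrow> (\<forall>g. distr L borel (\<lambda>x. x + g) = L))"

section \<open>Standard Borel spaces and smooth actions\<close>

definition standard_borel_space :: "'w measure \<Rightarrow> bool" where
  "standard_borel_space M \<longleftrightarrow>
     (\<exists>X. topspace X = space M \<and> completely_metrizable_space X \<and> second_countable X \<and>
          sets M = sigma_sets (topspace X) {U. openin X U})"

definition countably_separated :: "'w measure \<Rightarrow> bool" where
  "countably_separated M \<longleftrightarrow>
     (\<exists>\<A>. countable \<A> \<and> \<A> \<subseteq> sets M \<and>
        (\<forall>x\<in>space M. \<forall>y\<in>space M. x \<noteq> y \<longrightarrow> (\<exists>A\<in>\<A>. (x \<in> A) \<noteq> (y \<in> A))))"

text \<open>An action of \<open>'g\<close> on the underlying set of \<open>M\<close>; only its values on \<open>space M\<close> matter.\<close>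

definition borel_action :: "('g::topological_group_add \<Rightarrow> 'w \<Rightarrow> 'w) \<Rightarrow> 'w measure \<Rightarrow> bool" where
  "borel_action act M \<longleftrightarrow>
     (\<lambda>(g, x). act g x) \<in> measurable (borel \<Otimes>\<^sub>M M) M \<and>
     (\<forall>x\<in>space M. act 0 x = x) \<and>
     (\<forall>g h. \<forall>x\<in>space M. act (g + h) x = act g (act h x))"

definition free_action :: "('g::group_add \<Rightarrow> 'w \<Rightarrow> 'w) \<Rightarrow> 'w measure \<Rightarrow> bool" where
  "free_action act M \<longleftrightarrow> (\<forall>g. \<forall>x\<in>space M. act g x = x \<longrightarrow> g = 0)"

definition measure_preserving_action :: "('g \<Rightarrow> 'w \<Rightarrow> 'w) \<Rightarrow> 'w measure \<Rightarrow> bool" where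
  "measure_preserving_action act M \<longleftrightarrow> (\<forall>g. distr M M (act g) = M)"

definition act_orbit :: "('g \<Rightarrow> 'w \<Rightarrow> 'w) \<Rightarrow> 'w \<Rightarrow> 'w set" where
  "act_orbit act x = range (\<lambda>g. act g x)"

text \<open>
  The set of orbits with the final sigma-algebra of the quotient map. It is used only as a
  measurable space: \<^const>\<open>sigma\<close> equips it with the zero measure.
\<close>

definition orbit_space :: "('g \<Rightarrow> 'w \<Rightarrow> 'w) \<Rightarrow> 'w measure \<Rightarrow> 'w set measure" where
  "orbit_space act M =
     sigma (act_orbit act ` space M)
       {B. B \<subseteq> act_orbit act ` space M \<and> {x \<in> space M. act_orbit act x \<in> B} \<in> sets M}"

definition smooth_action :: "('g \<Rightarrow> 'w \<Rightarrow> 'w) \<Rightarrow> 'w measure \<Rightarrow> bool" where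
  "smooth_action act M \<longleftrightarrow> countably_separated (orbit_space act M)"

definition fundamental_domain :: "('g \<Rightarrow> 'w \<Rightarrow> 'w) \<Rightarrow> 'w measure \<Rightarrow> 'w set \<Rightarrow> bool" where
  "fundamental_domain act M F \<longleftrightarrow>
     (\<exists>\<sigma> \<in> measurable (orbit_space act M) M.
        (\<forall>x\<in>space M. act_orbit act (\<sigma> (act_orbit act x)) = act_orbit act x) \<and>
        F = \<sigma> ` space (orbit_space act M))"

definition measured_space_iso :: "('a \<Rightarrow> 'b) \<Rightarrow> 'a measure \<Rightarrow> 'b measure \<Rightarrow> bool" where
  "measured_space_iso f M N \<longleftrightarrow>
     f \<in> measurable M N \<and> bij_betw f (space M) (space N) \<and>
     inv_into (space M) f \<in> measurable N M \<and> distr M N f = N"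

section \<open>Measure subgroup couplings\<close>

definition measure_subgroup_coupling ::
    "'h::topological_group_add measure \<Rightarrow> 'g::topological_group_add measure \<Rightarrow> 'w measure \<Rightarrow>
     ('h \<Rightarrow> 'w \<Rightarrow> 'w) \<Rightarrow> ('g \<Rightarrow> 'w \<Rightarrow> 'w) \<Rightarrow> 'w set \<Rightarrow> 'w set \<Rightarrow>
     'w measure \<Rightarrow> 'w measure \<Rightarrow> bool" where
  "measure_subgroup_coupling L\<^sub>H L\<^sub>G M act\<^sub>H act\<^sub>G F\<^sub>H F\<^sub>G \<nu>\<^sub>H \<nu>\<^sub>G \<longleftrightarrow>
     standard_borel_space M \<and> emeasure M (space M) \<noteq> 0 \<and>
     borel_action act\<^sub>H M \<and> borel_action act\<^sub>G M \<and>
     (\<forall>h g. \<forall>x\<in>space M. act\<^sub>H h (act\<^sub>G g x) = act\<^sub>G g (act\<^sub>H h x)) \<and>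
     smooth_action act\<^sub>H M \<and> smooth_action act\<^sub>G M \<and>
     free_action act\<^sub>H M \<and> free_action act\<^sub>G M \<and>
     measure_preserving_action act\<^sub>H M \<and> measure_preserving_action act\<^sub>G M \<and>
     fundamental_domain act\<^sub>H M F\<^sub>H \<and> fundamental_domain act\<^sub>G M F\<^sub>G \<and>
     sets \<nu>\<^sub>H = sets (restrict_space M F\<^sub>H) \<and> sigma_finite_measure \<nu>\<^sub>H \<and>
     sets \<nu>\<^sub>G = sets (restrict_space M F\<^sub>G) \<and> finite_measure \<nu>\<^sub>G \<and>
     measured_space_iso (\<lambda>(g, x). act\<^sub>G g x) (L\<^sub>G \<Otimes>\<^sub>M \<nu>\<^sub>G) M \<and>
     measured_space_iso (\<lambda>(h, x). act\<^sub>H h x) (L\<^sub>H \<Otimes>\<^sub>M \<nu>\<^sub>H) M"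

definition induced_action ::
    "('h \<Rightarrow> 'w \<Rightarrow> 'w) \<Rightarrow> ('g \<Rightarrow> 'w \<Rightarrow> 'w) \<Rightarrow> 'w set \<Rightarrow> 'h \<Rightarrow> 'w \<Rightarrow> 'w" where
  "induced_action act\<^sub>H act\<^sub>G F\<^sub>G h x = (THE y. y \<in> F\<^sub>G \<and> y \<in> act_orbit act\<^sub>G (act\<^sub>H h x))"

definition coupling_cocycle ::
    "('h \<Rightarrow> 'w \<Rightarrow> 'w) \<Rightarrow> ('g \<Rightarrow> 'w \<Rightarrow> 'w) \<Rightarrow> 'w set \<Rightarrow> 'h \<Rightarrow> 'w \<Rightarrow> 'g" where
  "coupling_cocycle act\<^sub>H act\<^sub>G F\<^sub>G h x =
     (THE g. act\<^sub>H h x = act\<^sub>G g (induced_action act\<^sub>H act\<^sub>G F\<^sub>G h x))"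

text \<open>
  Extension of \<open>\<phi> : (0,\<infinity>) \<rightarrow> (0,\<infinity>)\<close> to \<open>[0,\<infinity>]\<close> by \<open>\<phi>(0) = 0\<close> and
  \<open>\<phi>(\<infinity>) = lim \<phi>(t)\<close> as \<open>t \<rightarrow> \<infinity>\<close>; the limit is taken in \<open>[0,\<infinity>]\<close>. Values of the given
  \<open>\<phi>\<close> outside \<open>(0,\<infinity>)\<close> are never used.
\<close>

definition extend_fun :: "(real \<Rightarrow> real) \<Rightarrow> ennreal \<Rightarrow> ennreal" where
  "extend_fun \<phi> t =
     (if t = 0 then 0
      else if t = \<infinity> then Lim at_top (\<lambda>u. ennreal (\<phi> u))
      else ennreal (\<phi> (enn2real t)))"

definition phi_integrable_coupling ::
    "(real \<Rightarrow> real) \<Rightarrow> 'h set \<Rightarrow> 'g::group_add set \<Rightarrow>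
     ('h \<Rightarrow> 'w \<Rightarrow> 'w) \<Rightarrow> ('g \<Rightarrow> 'w \<Rightarrow> 'w) \<Rightarrow> 'w set \<Rightarrow> 'w measure \<Rightarrow> bool" where
  "phi_integrable_coupling \<phi> S\<^sub>H S\<^sub>G act\<^sub>H act\<^sub>G F\<^sub>G \<nu>\<^sub>G \<longleftrightarrow>
     (SUP h\<in>S\<^sub>H. \<integral>\<^sup>+x.
        extend_fun \<phi> (of_nat (word_length S\<^sub>G (coupling_cocycle act\<^sub>H act\<^sub>G F\<^sub>G h x))) \<partial>\<nu>\<^sub>G) < \<infinity>"

definition coarsely_m_to_1 ::
    "nat \<Rightarrow> real \<Rightarrow> ('h::group_add \<Rightarrow> 'h \<Rightarrow> real) \<Rightarrow> ('g \<Rightarrow> 'g \<Rightarrow> real) \<Rightarrow>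
     ('h \<Rightarrow> 'w \<Rightarrow> 'w) \<Rightarrow> ('g \<Rightarrow> 'w \<Rightarrow> 'w) \<Rightarrow> 'w set \<Rightarrow> bool" where
  "coarsely_m_to_1 m s d\<^sub>H d\<^sub>G act\<^sub>H act\<^sub>G F\<^sub>G \<longleftrightarrow>
     (\<forall>x\<in>F\<^sub>G. \<forall>y. \<exists>C. finite C \<and> card C \<le> m \<and>
        (\<lambda>h. coupling_cocycle act\<^sub>H act\<^sub>G F\<^sub>G (- h) x) -` Metric_space.mball UNIV d\<^sub>G y 3
          \<subseteq> (\<Union>c\<in>C. Metric_space.mball UNIV d\<^sub>H c s))"

section \<open>Isoperimetric profiles\<close>

definition L1_norm :: "'a measure \<Rightarrow> ('a \<Rightarrow> real) \<Rightarrow> ennreal" where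
  "L1_norm L f = (\<integral>\<^sup>+x. ennreal \<bar>f x\<bar> \<partial>L)"

definition right_gradient_norm ::
    "'a::plus set \<Rightarrow> 'a measure \<Rightarrow> ('a \<Rightarrow> real) \<Rightarrow> ennreal" where
  "right_gradient_norm S L f = (SUP t\<in>S. L1_norm L (\<lambda>g. f g - f (g + t)))"

text \<open>
  In \<^typ>\<open>ennreal\<close>, \<open>x / 0 = \<infinity>\<close> for \<open>x \<noteq> 0\<close>, as required when the gradient vanishes.
\<close>

definition iso_ratio :: "'a::plus set \<Rightarrow> 'a measure \<Rightarrow> 'a set \<Rightarrow> ennreal" where
  "iso_ratio S L A =
     (SUP f\<in>{f. integrable L f \<and> L1_norm L f \<noteq> 0 \<and> (\<forall>g. g \<notin> A \<longrightarrow> f g = 0)}.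
        L1_norm L f / right_gradient_norm S L f)"

definition iso_profile :: "'a::plus set \<Rightarrow> 'a measure \<Rightarrow> real \<Rightarrow> ennreal" where
  "iso_profile S L v = (SUP A\<in>{A \<in> sets L. emeasure L A \<le> ennreal v}. iso_ratio S L A)"

definition asymp_preceq :: "(real \<Rightarrow> ennreal) \<Rightarrow> (real \<Rightarrow> ennreal) \<Rightarrow> bool" where
  "asymp_preceq a b \<longleftrightarrow>
     (\<exists>C>0. \<exists>K::real. K > 0 \<and> (\<forall>\<^sub>F v in at_top. a v \<le> ennreal K * b (C * v)))"

end

theory Submission
  imports Defs
begin

text \<open>
  A function \<open>f\<close> on \<open>G\<close> that is almost optimal for the profile is first cut down so that its
  support lies in a number of balls comparable to the volume of its support. It is then lifted to
  the coupling space by \<open>F (g * x) = f g\<close> for \<open>x\<close> in \<open>F\<^sub>G\<close>. The action of \<open>h\<close> moves \<open>F\<close>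
  by the average over \<open>x\<close> of the right translation distance of \<open>f\<close> by the cocycle, and
  interpolating this distance between \<open>|c(h, x)|\<close> times the gradient of \<open>f\<close> and twice its norm
  gives a bound by \<open>\<phi> |c(h, x)| / \<phi> (norm / gradient)\<close>. Disintegrating \<open>F\<close> over \<open>F\<^sub>H\<close>, some
  slice \<open>h \<mapsto> F (h\<inverse> * z)\<close> does at least as well as the average, and its support is covered by
  few balls because the coupling is coarsely \<open>m\<close>-to-1. As a slice is only selected with a gradient
  bound that is averaged over a ball of \<open>H\<close>, the slice is finally smoothed.
\<close>

section \<open>Unimodular groups with a proper metric\<close>

text \<open>The obstacle is that the groups need not be discrete. A set of finite volume in
  \<open>G\<close> may meet arbitrarily many unit balls, whereas the m-to-1 hypothesis counts balls;
  hence the cut to points around which the support is thick. In \<open>H\<close> the generating set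
  may be uncountable, so a slice cannot be selected by handling generators one at a time. The
  average of the displacement over a ball is just one more integral, to which Tonelli applies, and
  convolution with a ball turns the averaged bound back into one for every generator.

  The gradient refers to right translations, the actions are left actions. On \<open>G\<close> the
  two are reconciled by commutation: acting by \<open>h\<close> adds the cocycle on the right of the
  \<open>G\<close>-coordinate. On \<open>H\<close> they are reconciled by the inverse in the slice,
  and unimodularity is what lets slices integrate back to the coupling space, since inversion then
  preserves the Haar measure.

  Every loss is a constant factor: \<open>t / \<phi> t\<close> being non-decreasing moves constants
  from the argument of \<phi> to the outside, and losses in volume go into the dilation
  constant.\<close>

locale metric_haar_group =
  fixes S :: "'a::{topological_group_add, t2_space, second_countable_topology} set"
    and d :: "'a \<Rightarrow> 'a \<Rightarrow> real" and L :: "'a measure"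
  assumes gen: "compact_symmetric_generating S"
    and unimod: "unimodular TYPE('a)"
    and adm: "admissible_metric S d"
    and haar: "left_haar_measure L"
begin

sublocale ms: Metric_space UNIV d
  using adm by (simp add: admissible_metric_def)

section \<open>Balls about the identity\<close>

definition B :: "real \<Rightarrow> 'a set" where
  "B r = {x. d 0 x < r}"

lemma d_left_invariant: "d (g + x) (g + y) = d x y"
  using adm by (simp add: admissible_metric_def left_invariant_metric_def)

lemma d_shift: "d x y = d 0 (- x + y)"
  using d_left_invariant[of "- x" x y] by simp

lemma mball_iff: "y \<in> ms.mball x r \<longleftrightarrow> - x + y \<in> B r"
  by (simp add: B_def d_shift[of x y])

lemma B_iff: "x \<in> B r \<longleftrightarrow> d 0 x < r"
  by (simp add: B_def)

lemma d_zero_uminus: "d 0 (- x) = d 0 x"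
  using d_shift[of x 0] ms.commute[of x 0] by simp

lemma B_uminus: "- x \<in> B r \<longleftrightarrow> x \<in> B r"
  by (simp add: B_iff d_zero_uminus)

lemma B_mono: "r \<le> r' \<Longrightarrow> B r \<subseteq> B r'"
  by (auto simp: B_def)

lemma B_add: "x \<in> B r \<Longrightarrow> y \<in> B r' \<Longrightarrow> x + y \<in> B (r + r')"
  using ms.triangle[of 0 x "x + y"] d_shift[of x "x + y"] by (simp add: B_iff flip: add.assoc)

lemma zero_in_B: "0 < r \<Longrightarrow> 0 \<in> B r"
  by (simp add: B_iff)

lemma open_B: "open (B r)"
proof -
  have "openin ms.mtopology (ms.mball 0 r)" by (rule ms.openin_mball)
  moreover have "ms.mball 0 r = B r" by (auto simp: B_iff)
  moreover have "ms.mtopology = euclidean"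
    using adm by (simp add: admissible_metric_def)
  ultimately show ?thesis by (metis open_openin)
qed

lemma sets_L[simp, measurable_cong]: "sets L = sets borel"
  using haar by (simp add: left_haar_measure_def)

lemma space_L[simp]: "space L = UNIV"
  using sets_eq_imp_space_eq[OF sets_L] by simp

lemma B_measurable[measurable]: "B r \<in> sets borel"
  using open_B by simp

lemma finite_B: "emeasure L (B r) < \<infinity>"
proof -
  have c: "compact (ms.mcball 0 r)"
    using adm by (simp add: admissible_metric_def)
  have "emeasure L (B r) \<le> emeasure L (ms.mcball 0 r)"
    using c by (intro emeasure_mono) (auto simp: B_iff intro: borel_closed compact_imp_closed)
  also have "\<dots> < \<infinity>"
    using haar c by (simp add: left_haar_measure_def)
  finally show ?thesis .
qed

lemma UN_B: "(\<Union>n::nat. B (real n)) = UNIV"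
  by (auto simp: B_iff reals_Archimedean2)

sublocale sigma_finite_measure L
proof (rule sigma_finite_measure.intro, intro exI conjI)
  show "countable (range (\<lambda>n::nat. B (real n)))" by simp
  show "range (\<lambda>n::nat. B (real n)) \<subseteq> sets L" by auto
  show "\<Union> (range (\<lambda>n::nat. B (real n))) = space L" using UN_B by simp
  show "\<forall>a\<in>range (\<lambda>n::nat. B (real n)). emeasure L a \<noteq> \<infinity>"
    using finite_B by (metis imageE less_irrefl)
qed

sublocale LL: pair_sigma_finite L L ..

lemma minus_measurable[measurable]: "uminus \<in> borel_measurable (borel :: 'a measure)"
  by (intro borel_measurable_continuous_onI continuous_intros)

section \<open>Two-sided invariance of Haar measure\<close>

lemma distr_left: "distr L L (\<lambda>x. g + x) = L"
  using haar by (metis distr_cong left_haar_measure_def sets_L)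

lemma distr_right: "distr L L (\<lambda>x. x + g) = L"
  using haar unimod unfolding unimodular_def by (metis distr_cong sets_L)

lemma nn_integral_left:
  assumes "f \<in> borel_measurable borel"
  shows "(\<integral>\<^sup>+x. f (g + x) \<partial>L) = (\<integral>\<^sup>+x. f x \<partial>L)"
proof -
  have "(\<integral>\<^sup>+x. f x \<partial>distr L L (\<lambda>x. g + x)) = (\<integral>\<^sup>+x. f (g + x) \<partial>L)"
    using assms by (intro nn_integral_distr) auto
  then show ?thesis by (simp add: distr_left)
qed

lemma nn_integral_right:
  assumes "f \<in> borel_measurable borel"
  shows "(\<integral>\<^sup>+x. f (x + g) \<partial>L) = (\<integral>\<^sup>+x. f x \<partial>L)"
proof -
  have "(\<integral>\<^sup>+x. f x \<partial>distr L L (\<lambda>x. x + g)) = (\<integral>\<^sup>+x. f (x + g) \<partial>L)"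
    using assms by (intro nn_integral_distr) auto
  then show ?thesis by (simp add: distr_right)
qed

lemma emeasure_left:
  assumes "A \<in> sets borel"
  shows "emeasure L {x. g + x \<in> A} = emeasure L A"
proof -
  have "emeasure (distr L L (\<lambda>x. g + x)) A = emeasure L ((\<lambda>x. g + x) -` A \<inter> space L)"
    using assms by (intro emeasure_distr) auto
  then show ?thesis by (simp add: distr_left vimage_def)
qed

text \<open>If the ball were null, so would be all its left translates. By second countability
  countably many of them cover the group, and Haar measure would vanish.\<close>

lemma B_pos:
  assumes "0 < r"
  shows "0 < emeasure L (B r)"
proof (rule ccontr)
  assume "\<not> ?thesis"
  then have null: "emeasure L (B r) = 0" by simp
  have op: "open {y. - x + y \<in> B r}" for x
  proof -
    have "continuous_on UNIV (\<lambda>y. - x + y)" by (intro continuous_intros)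
    from open_vimage[OF open_B this] show ?thesis by (simp add: vimage_def)
  qed
  obtain F' where F': "F' \<subseteq> (\<lambda>x. {y. - x + y \<in> B r}) ` UNIV" "countable F'"
      "\<Union>F' = \<Union>((\<lambda>x. {y. - x + y \<in> B r}) ` UNIV)"
    using Lindelof[of "(\<lambda>x. {y. - x + y \<in> B r}) ` UNIV"] op by blast
  have "x \<in> \<Union>F'" for x
    using zero_in_B[OF assms] by (subst F'(3)) (auto intro!: exI[of _ x])
  then have "\<Union>F' = UNIV" by auto
  moreover have "A \<in> null_sets L" if "A \<in> F'" for A
    using that F'(1) op null emeasure_left[OF B_measurable] by (auto simp: null_sets_def)
  then have "\<Union>F' \<in> null_sets L"
    using null_sets_UN'[OF F'(2), of "\<lambda>x. x"] by simp
  ultimately show False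
    using haar by (auto simp: left_haar_measure_def null_sets_def)
qed

text \<open>With \<open>L'\<close> the image of \<open>L\<close> under inversion, evaluating
  \<open>\<integral>\<integral> f (x + y) * g y \<partial>L \<partial>L'\<close> in two ways gives
  \<open>(\<integral> f \<partial>L) * (\<integral> g \<partial>L') = (\<integral> f \<partial>L') * (\<integral> g \<partial>L')\<close>.\<close>

lemma nn_integral_uminus:
  assumes f[measurable]: "f \<in> borel_measurable borel"
  shows "(\<integral>\<^sup>+x. f (- x) \<partial>L) = (\<integral>\<^sup>+x. f x \<partial>L)"
proof -
  \<comment> \<open>The unit ball is symmetric and has positive finite measure, so its integral is
    the same for \<open>L\<close> and for the image of \<open>L\<close> under inversion, and it can
    be cancelled at the end.\<close>
  define g :: "'a \<Rightarrow> ennreal" where "g = indicator (B 1)"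
  have [measurable]: "g \<in> borel_measurable borel" by (simp add: g_def)
  have g_minus: "g (- x) = g x" for x by (simp add: g_def indicator_def B_uminus)
  have "(\<integral>\<^sup>+x. f x \<partial>L) * (\<integral>\<^sup>+y. g y \<partial>L) = (\<integral>\<^sup>+y. (\<integral>\<^sup>+x. f (x - y) * g y \<partial>L) \<partial>L)"
    using nn_integral_right[of f] by (simp add: nn_integral_cmult nn_integral_multc diff_conv_add_uminus del: add_uminus_conv_diff)
  also have "\<dots> = (\<integral>\<^sup>+x. (\<integral>\<^sup>+y. f (x - y) * g y \<partial>L) \<partial>L)"
    by (rule LL.Fubini') (simp add: diff_conv_add_uminus split_beta' del: add_uminus_conv_diff)
  also have "\<dots> = (\<integral>\<^sup>+x. (\<integral>\<^sup>+y. f (- y) * g (y + x) \<partial>L) \<partial>L)"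
  proof (rule nn_integral_cong)
    fix x
    show "(\<integral>\<^sup>+y. f (x - y) * g y \<partial>L) = (\<integral>\<^sup>+y. f (- y) * g (y + x) \<partial>L)"
      using nn_integral_right[of "\<lambda>y. f (x - y) * g y" x]
      by (simp add: diff_conv_add_uminus minus_add del: add_uminus_conv_diff flip: add.assoc)
  qed
  also have "\<dots> = (\<integral>\<^sup>+y. (\<integral>\<^sup>+x. f (- y) * g (y + x) \<partial>L) \<partial>L)"
    by (rule LL.Fubini') (simp add: split_beta')
  also have "\<dots> = (\<integral>\<^sup>+y. f (- y) \<partial>L) * (\<integral>\<^sup>+x. g x \<partial>L)"
    by (simp add: nn_integral_cmult nn_integral_multc nn_integral_left)
  finally have "(\<integral>\<^sup>+x. f x \<partial>L) * (\<integral>\<^sup>+y. g y \<partial>L) = (\<integral>\<^sup>+y. f (- y) \<partial>L) * (\<integral>\<^sup>+x. g x \<partial>L)" .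
  moreover have "(\<integral>\<^sup>+x. g x \<partial>L) = emeasure L (B 1)" by (simp add: g_def)
  ultimately show ?thesis
    using B_pos[of 1] finite_B[of 1]
    by (metis ennreal_mult_cancel_left infinity_ennreal_def less_irrefl mult.commute top.not_eq_extremum zero_less_one)
qed

end

section \<open>Translation distances and smoothing\<close>

lemma divide_left_mono_ennreal:
  assumes "a \<le> b" shows "c / b \<le> c / (a :: ennreal)"
proof -
  have "inverse b \<le> inverse a"
  proof (cases "a = 0 \<or> b = top")
    case False
    with assms obtain x y where "a = ennreal x" "0 < x" "b = ennreal y" "x \<le> y"
      by (cases a; cases b) (auto simp: less_le top_unique)
    then show ?thesis by (simp add: inverse_ennreal le_imp_inverse_le)
  qed auto
  then show ?thesis by (simp add: divide_ennreal_def mult_left_mono)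
qed

lemma ennreal_pos_finiteE:
  assumes "x \<noteq> 0" "x < \<infinity>"
  obtains r where "x = ennreal r" "0 < r"
  using assms by (cases x) (auto simp: less_le)

context metric_haar_group
begin

section \<open>Word length compared with the metric\<close>

lemma word_length_witness: "\<exists>xs. length xs = word_length S g \<and> set xs \<subseteq> S \<and> sum_list xs = g"
proof -
  have "\<exists>n xs. length xs = n \<and> set xs \<subseteq> S \<and> sum_list xs = g"
    using gen by (auto simp: compact_symmetric_generating_def)
  then show ?thesis
    unfolding word_length_def by (rule LeastI_ex)
qed

lemma word_length_eq_0: "word_length S g = 0 \<Longrightarrow> g = 0"
  using word_length_witness[of g] by auto

text \<open>Sum over the letters of a shortest word. The function is abstract because this serves
  both for right translation distances on \<open>G\<close> and for the displacement of the lifted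
  function under \<open>H\<close>.\<close>

lemma subadditive_le_word_length:
  fixes \<Phi> :: "'a \<Rightarrow> ennreal"
  assumes zero: "\<Phi> 0 = 0" and add: "\<And>u v. \<Phi> (u + v) \<le> \<Phi> u + \<Phi> v"
    and le: "\<And>t. t \<in> S \<Longrightarrow> \<Phi> t \<le> e"
  shows "\<Phi> u \<le> of_nat (word_length S u) * e"
proof -
  have "\<Phi> (sum_list xs) \<le> of_nat (length xs) * e" if "set xs \<subseteq> S" for xs
    using that
  proof (induction xs)
    case (Cons x xs)
    have "\<Phi> (x + sum_list xs) \<le> \<Phi> x + \<Phi> (sum_list xs)" by (rule add)
    also have "\<dots> \<le> e + of_nat (length xs) * e"
      using Cons by (intro add_mono le) auto
    finally show ?case by (simp add: distrib_right)
  qed (simp add: zero)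
  then show ?thesis using word_length_witness[of u] by metis
qed

lemma quasi_isometry:
  obtains a b where "1 \<le> a" "0 \<le> b"
    "\<And>y. real (word_length S y) / a - b \<le> d 0 y" "\<And>y. d 0 y \<le> a * real (word_length S y) + b"
proof -
  obtain a b where "1 \<le> a" "0 \<le> b" and *: "\<forall>x y. real (word_length S (- x + y)) / a - b \<le> d x y \<and>
        d x y \<le> a * real (word_length S (- x + y)) + b"
    using adm unfolding admissible_metric_def by metis
  with spec[OF *, of 0] show ?thesis by (intro that[of a b]) auto
qed

text \<open>This is the lower half of the quasi-isometry. The bound is made positive because it
  later enters constants that have to be positive.\<close>

lemma word_length_bounded: "\<exists>n>0. \<forall>u\<in>B r. word_length S u \<le> n"
proof -
  obtain a b where ab: "1 \<le> a" "0 \<le> b" "\<And>y. real (word_length S y) / a - b \<le> d 0 y"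
    using quasi_isometry by metis
  have "word_length S u \<le> Suc (nat \<lceil>(r + b) * a\<rceil>)" if "u \<in> B r" for u
  proof -
    have "real (word_length S u) / a \<le> r + b"
      using ab(3)[of u] that by (simp add: B_iff)
    then have "real (word_length S u) \<le> (r + b) * a"
      using ab(1) by (simp add: field_simps)
    then show ?thesis by linarith
  qed
  then show ?thesis by blast
qed

lemma generators_bounded: "\<exists>R>0. S \<subseteq> B R"
proof -
  obtain a b where ab: "1 \<le> a" "0 \<le> b" "\<And>y. d 0 y \<le> a * real (word_length S y) + b"
    using quasi_isometry by metis
  have "S \<subseteq> B (a + b + 1)"
  proof
    fix t assume "t \<in> S"
    then have "word_length S t \<le> 1"
      unfolding word_length_def by (intro Least_le exI[of _ "[t]"]) auto
    then have "a * real (word_length S t) \<le> a" using ab(1) by simp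
    with ab(3)[of t] show "t \<in> B (a + b + 1)" by (simp add: B_iff)
  qed
  then show ?thesis using ab by (intro exI[of _ "a + b + 1"]) auto
qed

text \<open>The norm of \<open>f - \<rho>(u) f\<close>, for arbitrary \<open>u\<close> and not only
  for generators, because cocycle values and points of a ball are inserted for
  \<open>u\<close>.\<close>

definition D :: "('a \<Rightarrow> real) \<Rightarrow> 'a \<Rightarrow> ennreal" where
  "D f u = L1_norm L (\<lambda>g. f g - f (g + u))"

lemma D_zero: "D f 0 = 0"
  by (simp add: D_def L1_norm_def)

lemma right_gradient_norm_eq: "right_gradient_norm S L f = (SUP t\<in>S. D f t)"
  by (simp add: right_gradient_norm_def D_def)

context
  fixes f :: "'a \<Rightarrow> real"
  assumes f[measurable]: "f \<in> borel_measurable borel"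
begin

lemma D_measurable[measurable]: "D f \<in> borel_measurable borel"
proof -
  have "(\<lambda>u. \<integral>\<^sup>+ g. ennreal \<bar>f g - f (g + u)\<bar> \<partial>L) \<in> borel_measurable borel"
    by measurable
  then show ?thesis by (simp add: D_def[abs_def] L1_norm_def)
qed

lemma nn_integral_abs_right: "(\<integral>\<^sup>+ g. ennreal \<bar>f (g + u)\<bar> \<partial>L) = L1_norm L f"
  using nn_integral_right[of "\<lambda>g. ennreal \<bar>f g\<bar>" u] by (simp add: L1_norm_def)

text \<open>By right invariance, the increment from \<open>g + u\<close> to \<open>g + u + v\<close>
  integrates over \<open>g\<close> to \<open>D f v\<close>.\<close>

lemma D_add: "D f (u + v) \<le> D f u + D f v"
proof -
  have "D f (u + v) \<le> (\<integral>\<^sup>+ g. ennreal \<bar>f g - f (g + u)\<bar> + ennreal \<bar>f (g + u) - f (g + u + v)\<bar> \<partial>L)"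
    unfolding D_def L1_norm_def
    by (intro nn_integral_mono) (auto simp: add.assoc simp flip: ennreal_plus intro!: ennreal_leI)
  also have "\<dots> = D f u + (\<integral>\<^sup>+ g. ennreal \<bar>f (g + u) - f (g + u + v)\<bar> \<partial>L)"
    by (simp add: nn_integral_add D_def L1_norm_def)
  also have "(\<integral>\<^sup>+ g. ennreal \<bar>f (g + u) - f (g + u + v)\<bar> \<partial>L) = D f v"
    using nn_integral_right[of "\<lambda>g. ennreal \<bar>f g - f (g + v)\<bar>" u] by (simp add: D_def L1_norm_def)
  finally show ?thesis .
qed

lemma D_le_norm: "D f u \<le> 2 * L1_norm L f"
proof -
  have "D f u \<le> (\<integral>\<^sup>+ g. ennreal \<bar>f g\<bar> + ennreal \<bar>f (g + u)\<bar> \<partial>L)"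
    unfolding D_def L1_norm_def
    by (intro nn_integral_mono) (auto simp flip: ennreal_plus intro!: ennreal_leI)
  also have "\<dots> = L1_norm L f + L1_norm L f"
    using nn_integral_abs_right by (simp add: nn_integral_add) (simp add: L1_norm_def)
  finally show ?thesis by (simp add: mult_2)
qed

lemma D_le_word_length: "D f u \<le> of_nat (word_length S u) * right_gradient_norm S L f"
  by (rule subadditive_le_word_length[OF D_zero D_add])
     (auto simp: right_gradient_norm_eq intro: SUP_upper)

text \<open>The error occurs twice, at \<open>g\<close> and at \<open>g + t\<close>, with equal norm
  by right invariance. This controls the gradient after the support has been cut down.\<close>

lemma gradient_le_perturb:
  assumes [measurable]: "h \<in> borel_measurable borel"
  shows "right_gradient_norm S L h \<le> right_gradient_norm S L f + 2 * L1_norm L (\<lambda>g. f g - h g)"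
proof -
  have "D h t \<le> right_gradient_norm S L f + 2 * L1_norm L (\<lambda>g. f g - h g)" if "t \<in> S" for t
  proof -
    have "D h t \<le> (\<integral>\<^sup>+ g. ennreal \<bar>f g - f (g + t)\<bar> +
        (ennreal \<bar>f g - h g\<bar> + ennreal \<bar>f (g + t) - h (g + t)\<bar>) \<partial>L)"
      unfolding D_def L1_norm_def
      by (intro nn_integral_mono) (auto simp flip: ennreal_plus intro!: ennreal_leI)
    also have "\<dots> = D f t + (L1_norm L (\<lambda>g. f g - h g) + L1_norm L (\<lambda>g. f g - h g))"
      using nn_integral_right[of "\<lambda>g. ennreal \<bar>f g - h g\<bar>" t]
      by (simp add: nn_integral_add D_def L1_norm_def)
    also have "D f t \<le> right_gradient_norm S L f"
      using that by (auto simp: right_gradient_norm_eq intro: SUP_upper)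
    finally show ?thesis by (simp add: mult_2)
  qed
  then show ?thesis by (auto simp: right_gradient_norm_eq[of h] intro: SUP_least)
qed

end

lemma L1_norm_nonneg: "(\<And>g. 0 \<le> f g) \<Longrightarrow> L1_norm L f = (\<integral>\<^sup>+g. ennreal (f g) \<partial>L)"
  by (simp add: L1_norm_def)

lemma integrable_left:
  assumes [measurable]: "f \<in> borel_measurable borel" and "L1_norm L f < \<infinity>"
  shows "integrable L (\<lambda>u. f (g + u))"
  using assms(2) nn_integral_left[of "\<lambda>x. ennreal \<bar>f x\<bar>" g]
  by (simp add: integrable_iff_bounded L1_norm_def)

text \<open>Convolving with the indicator of the unit ball turns a bound on the average of
  \<open>D f u\<close> over a ball into a bound that is uniform over the generators.\<close>

lemma smoothing:
  fixes f :: "'a \<Rightarrow> real"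
  assumes f[measurable]: "f \<in> borel_measurable borel" and f0: "\<And>g. 0 \<le> f g"
    and fin: "L1_norm L f < \<infinity>" and R: "S \<subseteq> B R" "0 < R"
  defines "\<psi> \<equiv> \<lambda>g. \<integral>u. indicator (B 1) u * f (g + u) \<partial>L"
  shows "\<psi> \<in> borel_measurable borel" "\<And>g. 0 \<le> \<psi> g"
    "L1_norm L \<psi> = emeasure L (B 1) * L1_norm L f"
    "right_gradient_norm S L \<psi> \<le> (\<integral>\<^sup>+u. D f u * indicator (B (R + 1)) u \<partial>L)"
    "\<And>g. \<psi> g \<noteq> 0 \<Longrightarrow> \<exists>u\<in>B 1. f (g + u) \<noteq> 0"
proof -
  show [measurable]: "\<psi> \<in> borel_measurable borel" unfolding \<psi>_def by measurable
  show \<psi>0: "0 \<le> \<psi> g" for g unfolding \<psi>_def by (intro integral_nonneg_AE) (simp add: f0)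
  have int: "integrable L (\<lambda>u. indicator A u * f (g + u))" if [measurable]: "A \<in> sets borel" for A g
    by (rule Bochner_Integration.integrable_bound[OF integrable_left[OF f fin, of g]])
       (auto simp: indicator_def)
  have \<psi>_nn: "ennreal (\<psi> g) = (\<integral>\<^sup>+u. indicator (B 1) u * ennreal (f (g + u)) \<partial>L)" for g
    unfolding \<psi>_def
    by (subst nn_integral_eq_integral[symmetric, OF int])
       (auto simp: f0 ennreal_mult' ennreal_indicator intro!: nn_integral_cong)
  have "L1_norm L \<psi> = (\<integral>\<^sup>+g. (\<integral>\<^sup>+u. indicator (B 1) u * ennreal (f (g + u)) \<partial>L) \<partial>L)"
    by (simp add: L1_norm_nonneg \<psi>0 \<psi>_nn)
  also have "\<dots> = (\<integral>\<^sup>+u. (\<integral>\<^sup>+g. indicator (B 1) u * ennreal (f (g + u)) \<partial>L) \<partial>L)"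
    by (rule LL.Fubini') (simp add: split_beta')
  also have "\<dots> = (\<integral>\<^sup>+u. indicator (B 1) u * L1_norm L f \<partial>L)"
    using nn_integral_abs_right[OF f] by (simp add: nn_integral_cmult f0)
  also have "\<dots> = emeasure L (B 1) * L1_norm L f"
    by (simp add: nn_integral_multc)
  finally show "L1_norm L \<psi> = emeasure L (B 1) * L1_norm L f" .
  show "\<exists>u\<in>B 1. f (g + u) \<noteq> 0" if "\<psi> g \<noteq> 0" for g
  proof (rule ccontr)
    assume "\<not> ?thesis"
    then have "(\<lambda>u. indicator (B 1) u * f (g + u)) = (\<lambda>_. 0)" by (auto simp: indicator_def)
    with that show False by (simp add: \<psi>_def)
  qed
  have "D \<psi> t \<le> (\<integral>\<^sup>+u. D f u * indicator (B (R + 1)) u \<partial>L)" if t: "t \<in> S" for t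
  proof -
    \<comment> \<open>The value \<open>\<psi> (g + t)\<close> is the integral of \<open>f\<close>
      over the ball shifted by \<open>t\<close>, so two balls around \<open>g\<close> are compared.
      Both lie in \<open>B (R + 1)\<close> because \<open>t\<close> lies in
      \<open>B R\<close>.\<close>
    define tB where "tB = {u. - t + u \<in> B 1}"
    have [measurable]: "tB \<in> sets borel"
      using open_vimage[OF open_B[of 1], of "\<lambda>u. - t + u"]
      by (auto simp: tB_def vimage_def intro!: borel_open continuous_intros)
    have em: "emeasure L tB = emeasure L (B 1)"
      unfolding tB_def by (rule emeasure_left) simp
    have sub: "\<bar>indicator (B 1) u - indicator tB u\<bar> \<le> (indicator (B (R + 1)) u :: real)" for u
    proof -
      have "u \<in> B (R + 1)" if "u \<in> tB"
        using B_add[of t R "- t + u" 1] that t R by (auto simp: tB_def simp flip: add.assoc)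
      moreover have "u \<in> B (R + 1)" if "u \<in> B 1"
        using B_mono[of 1 "R + 1"] R(2) that by auto
      ultimately show ?thesis by (auto simp: indicator_def)
    qed
    have pt: "ennreal \<bar>\<psi> g - \<psi> (g + t)\<bar> \<le>
        (\<integral>\<^sup>+u. ennreal \<bar>f g - f (g + u)\<bar> * indicator (B (R + 1)) u \<partial>L)" for g
    proof -
      have shift: "\<psi> (g + t) = (\<integral>u. indicator tB u * f (g + u) \<partial>L)"
      proof -
        have "(\<integral>u. indicator tB u * f (g + u) \<partial>L) = (\<integral>u. indicator tB u * f (g + u) \<partial>distr L L (\<lambda>x. t + x))"
          by (simp add: distr_left)
        also have "\<dots> = (\<integral>u. indicator tB (t + u) * f (g + (t + u)) \<partial>L)"
          by (rule integral_distr) auto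
        also have "\<dots> = \<psi> (g + t)"
          unfolding \<psi>_def by (intro Bochner_Integration.integral_cong) (auto simp: tB_def indicator_def add.assoc simp flip: add.assoc[of "- t"])
        finally show ?thesis by simp
      qed
      have fin': "emeasure L A < \<infinity> \<Longrightarrow> A \<in> sets borel \<Longrightarrow> integrable L (\<lambda>u. indicator A u * c)" for A and c :: real
        by (intro integrable_mult_left) simp
      \<comment> \<open>The two balls have equal measure, so the constant \<open>f g\<close> may be
        subtracted under both integrals; only increments \<open>f (g + u) - f g\<close>
        remain.\<close>
      have cst: "(\<integral>u. indicator (B 1) u * f g \<partial>L) = (\<integral>u. indicator tB u * f g \<partial>L)"
        using em by (simp add: measure_def)
      have "\<psi> g - \<psi> (g + t) = (\<integral>u. (indicator (B 1) u * f (g + u) - indicator tB u * f (g + u)) -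
          (indicator (B 1) u * f g - indicator tB u * f g) \<partial>L)"
        unfolding shift unfolding \<psi>_def using cst
        by (simp only: Bochner_Integration.integral_diff Bochner_Integration.integrable_diff
            int fin' finite_B em order_refl B_measurable \<open>tB \<in> sets borel\<close> diff_self diff_zero)
      also have "\<dots> = (\<integral>u. (indicator (B 1) u - indicator tB u) * (f (g + u) - f g) \<partial>L)"
        by (intro Bochner_Integration.integral_cong) (auto simp: algebra_simps)
      finally have eq: "\<psi> g - \<psi> (g + t) = (\<integral>u. (indicator (B 1) u - indicator tB u) * (f (g + u) - f g) \<partial>L)" .
      have integ: "integrable L (\<lambda>u. (indicator (B 1) u - indicator tB u) * (f (g + u) - f g))"
      proof -
        have "integrable L (\<lambda>u. (indicator (B 1) u * f (g + u) - indicator tB u * f (g + u)) -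
          (indicator (B 1) u * f g - indicator tB u * f g))"
          by (intro Bochner_Integration.integrable_diff int fin') (use finite_B[of 1] in \<open>auto simp: em\<close>)
        then show ?thesis by (simp add: algebra_simps)
      qed
      have "ennreal \<bar>\<psi> g - \<psi> (g + t)\<bar> \<le>
          (\<integral>\<^sup>+u. norm ((indicator (B 1) u - indicator tB u) * (f (g + u) - f g)) \<partial>L)"
        unfolding eq real_norm_def[symmetric] by (rule integral_norm_bound_ennreal[OF integ])
      also have "\<dots> \<le> (\<integral>\<^sup>+u. ennreal \<bar>f g - f (g + u)\<bar> * indicator (B (R + 1)) u \<partial>L)"
      proof (intro nn_integral_mono)
        fix u
        have "norm ((indicator (B 1) u - indicator tB u) * (f (g + u) - f g)) \<le> \<bar>f g - f (g + u)\<bar> * indicator (B (R + 1)) u"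
          using mult_right_mono[OF sub[of u], of "\<bar>f g - f (g + u)\<bar>"]
          by (simp add: abs_mult abs_minus_commute mult.commute)
        then have "ennreal (norm ((indicator (B 1) u - indicator tB u) * (f (g + u) - f g))) \<le> ennreal (\<bar>f g - f (g + u)\<bar> * indicator (B (R + 1)) u)"
          by (rule ennreal_leI)
        also have "\<dots> = ennreal \<bar>f g - f (g + u)\<bar> * indicator (B (R + 1)) u"
          by (simp add: indicator_def)
        finally show "ennreal (norm ((indicator (B 1) u - indicator tB u) * (f (g + u) - f g))) \<le> ennreal \<bar>f g - f (g + u)\<bar> * indicator (B (R + 1)) u" .
      qed
      finally show ?thesis .
    qed
    have "D \<psi> t \<le> (\<integral>\<^sup>+g. (\<integral>\<^sup>+u. ennreal \<bar>f g - f (g + u)\<bar> * indicator (B (R + 1)) u \<partial>L) \<partial>L)"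
      unfolding D_def L1_norm_def by (intro nn_integral_mono pt)
    also have "\<dots> = (\<integral>\<^sup>+u. (\<integral>\<^sup>+g. ennreal \<bar>f g - f (g + u)\<bar> * indicator (B (R + 1)) u \<partial>L) \<partial>L)"
      by (rule LL.Fubini') (simp add: split_beta')
    also have "\<dots> = (\<integral>\<^sup>+u. D f u * indicator (B (R + 1)) u \<partial>L)"
      by (simp add: nn_integral_multc D_def L1_norm_def)
    finally show ?thesis .
  qed
  then show "right_gradient_norm S L \<psi> \<le> (\<integral>\<^sup>+u. D f u * indicator (B (R + 1)) u \<partial>L)"
    by (auto simp: right_gradient_norm_eq intro: SUP_least)
qed

section \<open>Lower bounds for the profile from test functions\<close>

lemma emeasure_cover_le:
  assumes "finite C"
  shows "{g. \<exists>c\<in>C. - c + g \<in> B r} \<in> sets borel"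
    "emeasure L {g. \<exists>c\<in>C. - c + g \<in> B r} \<le> of_nat (card C) * emeasure L (B r)"
proof -
  have [measurable]: "{g. - c + g \<in> B r} \<in> sets borel" for c
    using open_vimage[OF open_B[of r], of "\<lambda>u. - c + u"]
    by (auto simp: vimage_def intro!: borel_open continuous_intros)
  have eq: "{g. \<exists>c\<in>C. - c + g \<in> B r} = (\<Union>c\<in>C. {g. - c + g \<in> B r})" by auto
  show "{g. \<exists>c\<in>C. - c + g \<in> B r} \<in> sets borel"
    unfolding eq using assms by (intro sets.finite_UN) auto
  have "emeasure L (\<Union>c\<in>C. {g. - c + g \<in> B r}) \<le> (\<Sum>c\<in>C. emeasure L {g. - c + g \<in> B r})"
    using assms by (intro emeasure_subadditive_finite) auto
  also have "\<dots> = of_nat (card C) * emeasure L (B r)"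
    by (simp add: emeasure_left)
  finally show "emeasure L {g. \<exists>c\<in>C. - c + g \<in> B r} \<le> of_nat (card C) * emeasure L (B r)"
    unfolding eq .
qed

lemma iso_profile_ge:
  assumes [measurable]: "f \<in> borel_measurable borel" "A \<in> sets borel"
    and "L1_norm L f \<noteq> 0" "L1_norm L f < \<infinity>" "\<And>g. g \<notin> A \<Longrightarrow> f g = 0" "emeasure L A \<le> ennreal v"
  shows "L1_norm L f / right_gradient_norm S L f \<le> iso_profile S L v"
proof -
  have "integrable L f"
    using assms(4) by (simp add: integrable_iff_bounded L1_norm_def)
  then have "L1_norm L f / right_gradient_norm S L f \<le> iso_ratio S L A"
    using assms unfolding iso_ratio_def by (intro SUP_upper) auto
  also have "\<dots> \<le> iso_profile S L v"
    using assms unfolding iso_profile_def by (intro SUP_upper) auto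
  finally show ?thesis .
qed

text \<open>The test function is the smoothing of \<open>f\<close>. Smoothing multiplies the norm by
  \<open>emeasure L (B 1)\<close>, the left side of the conclusion, and spreads the support by
  distance 1, hence the radius \<open>s + 1\<close> in the volume condition.\<close>

lemma iso_profile_ge_averaged:
  fixes f :: "'a \<Rightarrow> real"
  assumes f[measurable]: "f \<in> borel_measurable borel" and f0: "\<And>g. 0 \<le> f g"
    and fin: "L1_norm L f \<noteq> 0" "L1_norm L f < \<infinity>" and R: "S \<subseteq> B R" "0 < R"
    and e: "0 < e" and avg: "(\<integral>\<^sup>+u. D f u * indicator (B (R + 1)) u \<partial>L) \<le> ennreal e * L1_norm L f"
    and C: "finite C" "\<And>g. f g \<noteq> 0 \<Longrightarrow> \<exists>c\<in>C. - c + g \<in> B s"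
    and v: "of_nat (card C) * emeasure L (B (s + 1)) \<le> ennreal v"
  shows "emeasure L (B 1) \<le> ennreal e * iso_profile S L v"
proof -
  define \<psi> where "\<psi> = (\<lambda>g. \<integral>u. indicator (B 1) u * f (g + u) \<partial>L)"
  note sm = smoothing[OF f f0 fin(2) R, folded \<psi>_def]
  have sm5: "\<exists>u\<in>B 1. f (g + u) \<noteq> 0" if "\<psi> g \<noteq> 0" for g
    using smoothing(5)[OF f f0 fin(2) R, of g] that by (simp add: \<psi>_def)
  have supp: "\<psi> g = 0" if "g \<notin> {g. \<exists>c\<in>C. - c + g \<in> B (s + 1)}" for g
  proof (rule ccontr)
    assume "\<psi> g \<noteq> 0"
    then obtain u where u: "u \<in> B 1" "f (g + u) \<noteq> 0" using sm5 by blast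
    then obtain c where "c \<in> C" "- c + (g + u) \<in> B s" using C by blast
    moreover have "- c + (g + u) + - u = - c + g" by (simp flip: add.assoc)
    ultimately show False
      using B_add[of "- c + (g + u)" s "- u" 1] u(1) that B_uminus by (metis (mono_tags, lifting) mem_Collect_eq)
  qed
  have w: "0 < emeasure L (B 1)" "emeasure L (B 1) < \<infinity>" using B_pos finite_B by auto
  have "L1_norm L \<psi> / right_gradient_norm S L \<psi> \<le> iso_profile S L v"
    using emeasure_cover_le[OF C(1), of "s + 1"] v w fin supp
    by (intro iso_profile_ge[OF sm(1)]) (auto simp: sm(3) ennreal_mult_less_top)
  moreover have "L1_norm L \<psi> / (ennreal e * L1_norm L f) \<le> L1_norm L \<psi> / right_gradient_norm S L \<psi>"
    using sm(4) avg by (intro divide_left_mono_ennreal) simp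
  ultimately have le: "emeasure L (B 1) * L1_norm L f / (ennreal e * L1_norm L f) \<le> iso_profile S L v"
    by (simp add: sm(3))
  obtain n where n: "L1_norm L f = ennreal n" "0 < n"
    using ennreal_pos_finiteE[OF fin] .
  obtain w' where w': "emeasure L (B 1) = ennreal w'" "0 < w'"
    using ennreal_pos_finiteE w by (metis less_irrefl)
  have "ennreal (w' / e) \<le> iso_profile S L v"
    using le n w' e by (simp add: divide_ennreal flip: ennreal_mult)
  then have "ennreal e * ennreal (w' / e) \<le> ennreal e * iso_profile S L v"
    by (rule mult_left_mono) simp
  then show ?thesis using w' e by (simp flip: ennreal_mult)
qed

subsection \<open>Functions with coarse support\<close>

text \<open>Choose a largest set of points of \<open>A'\<close> with pairwise disjoint unit balls.
  It exists because each of these balls has at least half of its volume in \<open>A\<close>, which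
  bounds their number. By maximality the unit ball of any point of \<open>A'\<close> meets one of
  them, so the point is within distance 2. The weaker radius 3 is the one in the m-to-1
  condition.\<close>

lemma finite_packing:
  assumes A[measurable]: "A \<in> sets borel" and fin: "emeasure L A < \<infinity>"
  defines "dens \<equiv> \<lambda>g. \<integral>\<^sup>+u. indicator (B 1) u * indicator A (g + u) \<partial>L"
  assumes A': "\<And>g. g \<in> A' \<Longrightarrow> emeasure L (B 1) \<le> 2 * dens g"
  obtains P where "finite P" "of_nat (card P) * emeasure L (B 1) \<le> 2 * emeasure L A"
    "\<And>g. g \<in> A' \<Longrightarrow> \<exists>p\<in>P. - p + g \<in> B 3"
proof -
  define Q where "Q P \<longleftrightarrow> finite P \<and> P \<subseteq> A' \<and>
    (\<forall>p\<in>P. \<forall>q\<in>P. \<forall>x. - p + x \<in> B 1 \<and> - q + x \<in> B 1 \<longrightarrow> p = q)" for P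
  have meas[measurable]: "(\<lambda>x. indicator (B 1) (- p + x) :: ennreal) \<in> borel_measurable borel" for p
    by measurable
  have card_le: "of_nat (card P) * emeasure L (B 1) \<le> 2 * emeasure L A" if "Q P" for P
  proof -
    have [simp]: "finite P" using that by (simp add: Q_def)
    have "of_nat (card P) * emeasure L (B 1) = (\<Sum>p\<in>P. emeasure L (B 1))" by simp
    also have "\<dots> \<le> (\<Sum>p\<in>P. 2 * dens p)"
      using that A' by (intro sum_mono) (auto simp: Q_def)
    also have "\<dots> = 2 * (\<Sum>p\<in>P. \<integral>\<^sup>+x. indicator (B 1) (- p + x) * indicator A x \<partial>L)"
      unfolding dens_def
      using nn_integral_left[of "\<lambda>x. indicator (B 1) (- p + x) * indicator A x" p for p]
      by (simp add: sum_distrib_left flip: add.assoc)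
    also have "(\<Sum>p\<in>P. \<integral>\<^sup>+x. indicator (B 1) (- p + x) * indicator A x \<partial>L) =
        (\<integral>\<^sup>+x. (\<Sum>p\<in>P. indicator (B 1) (- p + x)) * indicator A x \<partial>L)"
      by (subst nn_integral_sum[symmetric]) (auto simp: sum_distrib_right)
    also have "\<dots> \<le> (\<integral>\<^sup>+x. indicator A x \<partial>L)"
    proof (intro nn_integral_mono)
      fix x
      have "(\<Sum>p\<in>P. indicator (B 1) (- p + x)) = (of_nat (card {p \<in> P. - p + x \<in> B 1}) :: ennreal)"
        by (simp add: indicator_def sum.If_cases Int_def)
      also have "card {p \<in> P. - p + x \<in> B 1} \<le> 1"
        using that by (auto simp: Q_def card_le_Suc0_iff_eq)
      then have "(of_nat (card {p \<in> P. - p + x \<in> B 1}) :: ennreal) \<le> 1"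
        by (metis of_nat_1 of_nat_mono)
      finally show "(\<Sum>p\<in>P. indicator (B 1) (- p + x)) * indicator A x \<le> (indicator A x :: ennreal)"
        by (simp add: indicator_def)
    qed
    finally show ?thesis by (simp add: mult_left_mono)
  qed
  have w: "0 < emeasure L (B 1)" "emeasure L (B 1) < \<infinity>" using B_pos finite_B by auto
  have "card P \<le> nat \<lceil>2 * measure L A / measure L (B 1)\<rceil>" if "Q P" for P
  proof -
    have "real (card P) * measure L (B 1) \<le> 2 * measure L A"
      using card_le[OF that] fin w
      by (simp add: emeasure_eq_ennreal_measure less_top flip: ennreal_of_nat_eq_real_of_nat ennreal_mult
            ennreal_numeral)
         (metis (no_types, opaque_lifting) ennreal_le_iff ennreal_mult ennreal_numeral ennreal_of_nat_eq_real_of_nat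
          measure_nonneg mult_nonneg_nonneg of_nat_0_le_iff zero_le_numeral)
    moreover have "0 < measure L (B 1)"
      using w by (simp add: emeasure_eq_ennreal_measure less_top)
    ultimately have "real (card P) \<le> 2 * measure L A / measure L (B 1)"
      by (simp add: field_simps)
    then show ?thesis by linarith
  qed
  moreover have "Q {}" by (simp add: Q_def)
  ultimately obtain P where P: "Q P" and max: "\<And>P'. Q P' \<Longrightarrow> card P' \<le> card P"
    using Lattices_Big.ex_has_greatest_nat[of Q "{}" card "Suc (nat \<lceil>2 * measure L A / measure L (B 1)\<rceil>)"]
    by (metis le_imp_less_Suc)
  show ?thesis
  proof (rule that)
    show "finite P" using P by (simp add: Q_def)
    show "of_nat (card P) * emeasure L (B 1) \<le> 2 * emeasure L A" by (rule card_le[OF P])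
    fix g assume g: "g \<in> A'"
    show "\<exists>p\<in>P. - p + g \<in> B 3"
    proof (cases "g \<in> P")
      case True
      then show ?thesis by (intro bexI[of _ g]) (auto simp: zero_in_B)
    next
      case False
      then have nQ: "\<not> Q (insert g P)"
        using max[of "insert g P"] P by (auto simp: Q_def)
      have "\<exists>p\<in>P. \<exists>x. - p + x \<in> B 1 \<and> - g + x \<in> B 1"
      proof (rule ccontr)
        assume "\<not> ?thesis"
        then have "Q (insert g P)" using P g by (auto simp: Q_def)
        with nQ show False by contradiction
      qed
      then obtain p x where p: "p \<in> P" "- p + x \<in> B 1" "- g + x \<in> B 1" by blast
      have "- p + g \<in> B (1 + 1)"
        using B_add[OF p(2), of "- (- g + x)" 1] p(3) unfolding B_uminus
        by (simp add: minus_add add.assoc)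
      then show ?thesis using p(1) B_mono[of "1 + 1" 3] by auto
    qed
  qed
qed

text \<open>Where the unit ball around a point is less than half filled by the support \<open>A\<close>, the value of
  \<open>f\<close> is controlled by its local variation, so cutting \<open>f\<close> off there costs little.\<close>

lemma thick_support:
  fixes f :: "'a \<Rightarrow> real"
  assumes f[measurable]: "f \<in> borel_measurable borel" and f0: "\<And>g. 0 \<le> f g"
    and A[measurable]: "A \<in> sets borel" and fin: "emeasure L A < \<infinity>"
    and supp: "\<And>g. g \<notin> A \<Longrightarrow> f g = 0"
    and n: "\<And>u. u \<in> B 1 \<Longrightarrow> word_length S u \<le> n"
  obtains f' P where "f' \<in> borel_measurable borel" "\<And>g. 0 \<le> f' g" "\<And>g. f' g \<le> f g"
    "L1_norm L (\<lambda>g. f g - f' g) \<le> 2 * of_nat n * right_gradient_norm S L f"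
    "finite P" "of_nat (card P) * emeasure L (B 1) \<le> 2 * emeasure L A"
    "\<And>g. f' g \<noteq> 0 \<Longrightarrow> \<exists>p\<in>P. - p + g \<in> B 3"
proof -
  define dens :: "'a \<Rightarrow> ennreal"
    where "dens g = (\<integral>\<^sup>+u. indicator (B 1) u * indicator A (g + u) \<partial>L)" for g
  have [measurable]: "dens \<in> borel_measurable borel" unfolding dens_def[abs_def] by measurable
  define A' where "A' = {g \<in> A. emeasure L (B 1) \<le> 2 * dens g}"
  have [measurable]: "A' \<in> sets borel" unfolding A'_def by measurable
  obtain P where P: "finite P" "of_nat (card P) * emeasure L (B 1) \<le> 2 * emeasure L A"
    "\<And>g. g \<in> A' \<Longrightarrow> \<exists>p\<in>P. - p + g \<in> B 3"
    by (rule finite_packing[OF A fin, of A']) (auto simp: A'_def dens_def)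
  define f' where "f' g = f g * indicator A' g" for g
  have w: "0 < emeasure L (B 1)" "emeasure L (B 1) < \<infinity>" using B_pos finite_B by auto
  have local: "ennreal \<bar>f g - f' g\<bar> * emeasure L (B 1) \<le>
      2 * (\<integral>\<^sup>+u. ennreal \<bar>f g - f (g + u)\<bar> * indicator (B 1) u \<partial>L)" (is "_ \<le> 2 * ?I") for g
  proof (cases "g \<in> A - A'")
    case True
    then have dens: "2 * dens g \<le> emeasure L (B 1)" by (auto simp: A'_def)
    have "ennreal (f g) * emeasure L (B 1) = (\<integral>\<^sup>+u. ennreal (f g) * indicator (B 1) u \<partial>L)"
      by (simp add: nn_integral_cmult)
    \<comment> \<open>Split the ball around \<open>g\<close>: off \<open>A\<close> the increment is
      \<open>f g\<close> itself, as \<open>f (g + u) = 0\<close>, and the part inside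
      \<open>A\<close> is paid for by the second summand.\<close>
    also have "\<dots> \<le> (\<integral>\<^sup>+u. ennreal \<bar>f g - f (g + u)\<bar> * indicator (B 1) u +
        ennreal (f g) * (indicator (B 1) u * indicator A (g + u)) \<partial>L)"
      by (intro nn_integral_mono) (auto simp: indicator_def supp)
    also have "\<dots> = ?I + ennreal (f g) * dens g"
      by (simp add: nn_integral_add nn_integral_cmult dens_def)
    finally have 1: "ennreal (f g) * emeasure L (B 1) \<le> ?I + ennreal (f g) * dens g" .
    \<comment> \<open>After doubling, the thinness \<open>2 * dens g \<le> emeasure L (B 1)\<close>
      bounds the last term by one of the two copies on the left, which is finite and
      cancels.\<close>
    have "ennreal (f g) * emeasure L (B 1) + ennreal (f g) * emeasure L (B 1) \<le>
        2 * ?I + ennreal (f g) * (2 * dens g)"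
      using add_mono[OF 1 1] by (simp only: mult_2 distrib_left add_ac)
    also have "\<dots> \<le> 2 * ?I + ennreal (f g) * emeasure L (B 1)"
      using dens by (intro add_left_mono mult_left_mono) auto
    finally have "ennreal (f g) * emeasure L (B 1) \<le> 2 * ?I"
      using w by (auto simp: add.commute[of "2 * ?I"] ennreal_mult_eq_top_iff)
    then show ?thesis using True f0 by (simp add: f'_def)
  next
    case False
    then have "f g - f' g = 0" by (auto simp: f'_def supp)
    then show ?thesis by simp
  qed
  have [measurable]: "f' \<in> borel_measurable borel" unfolding f'_def[abs_def] by measurable
  have "L1_norm L (\<lambda>g. f g - f' g) * emeasure L (B 1) = (\<integral>\<^sup>+g. ennreal \<bar>f g - f' g\<bar> * emeasure L (B 1) \<partial>L)"
    by (simp add: L1_norm_def nn_integral_multc)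
  also have "\<dots> \<le> (\<integral>\<^sup>+g. 2 * (\<integral>\<^sup>+u. ennreal \<bar>f g - f (g + u)\<bar> * indicator (B 1) u \<partial>L) \<partial>L)"
    by (intro nn_integral_mono local)
  also have "\<dots> = 2 * (\<integral>\<^sup>+g. (\<integral>\<^sup>+u. ennreal \<bar>f g - f (g + u)\<bar> * indicator (B 1) u \<partial>L) \<partial>L)"
    by (intro nn_integral_cmult) measurable
  also have "(\<integral>\<^sup>+g. (\<integral>\<^sup>+u. ennreal \<bar>f g - f (g + u)\<bar> * indicator (B 1) u \<partial>L) \<partial>L) =
      (\<integral>\<^sup>+u. (\<integral>\<^sup>+g. ennreal \<bar>f g - f (g + u)\<bar> * indicator (B 1) u \<partial>L) \<partial>L)"
    by (rule LL.Fubini') (simp add: split_beta')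
  also have "\<dots> = (\<integral>\<^sup>+u. D f u * indicator (B 1) u \<partial>L)"
    by (simp add: nn_integral_multc D_def L1_norm_def)
  also have "\<dots> \<le> (\<integral>\<^sup>+u. of_nat n * right_gradient_norm S L f * indicator (B 1) u \<partial>L)"
  proof (intro nn_integral_mono)
    fix u
    show "D f u * indicator (B 1) u \<le> of_nat n * right_gradient_norm S L f * indicator (B 1) u"
    proof (cases "u \<in> B 1")
      case True
      have "D f u \<le> of_nat (word_length S u) * right_gradient_norm S L f"
        by (rule D_le_word_length[OF f])
      also have "\<dots> \<le> of_nat n * right_gradient_norm S L f"
        using n[OF True] by (intro mult_right_mono) auto
      finally show ?thesis using True by simp
    qed simp
  qed
  also have "\<dots> = of_nat n * right_gradient_norm S L f * emeasure L (B 1)"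
    by (simp add: nn_integral_cmult)
  finally have "L1_norm L (\<lambda>g. f g - f' g) * emeasure L (B 1) \<le>
      2 * of_nat n * right_gradient_norm S L f * emeasure L (B 1)"
    by (simp add: mult.assoc mult_left_mono)
  then have "L1_norm L (\<lambda>g. f g - f' g) \<le> 2 * of_nat n * right_gradient_norm S L f"
    using w by (metis ennreal_mult_le_mult_iff infinity_ennreal_def mult.commute not_gr_zero top.not_eq_extremum)
  with P show ?thesis
    by (intro that[of f' P]) (auto simp: f'_def f0 indicator_def split: if_splits)
qed

text \<open>Take the absolute value of a function with ratio above \<open>t\<close> and cut it down
  to its thick part. Because \<open>4 * real n \<le> t\<close>, the cut removes at most half of the
  norm, and the gradient bound grows by a factor of at most \<open>1 + 4 * real n\<close>; the two
  losses multiply to \<open>2 * (1 + 4 * real n)\<close>.\<close>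

lemma almost_optimal_function:
  assumes n: "\<And>u. u \<in> B 1 \<Longrightarrow> word_length S u \<le> n"
    and t: "4 * real n \<le> t" "0 < t" "ennreal t < iso_profile S L v"
  obtains f P where "f \<in> borel_measurable borel" "\<And>g. 0 \<le> f g" "L1_norm L f \<noteq> 0" "L1_norm L f < \<infinity>"
    "ennreal t * right_gradient_norm S L f \<le> ennreal (2 * (1 + 4 * real n)) * L1_norm L f"
    "finite P" "of_nat (card P) * emeasure L (B 1) \<le> 2 * ennreal v"
    "\<And>g. f g \<noteq> 0 \<Longrightarrow> \<exists>p\<in>P. - p + g \<in> B 3"
proof -
  obtain A f0 where A: "A \<in> sets borel" "emeasure L A \<le> ennreal v"
    and f0: "integrable L f0" "L1_norm L f0 \<noteq> 0" "\<And>g. g \<notin> A \<Longrightarrow> f0 g = 0"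
      "ennreal t < L1_norm L f0 / right_gradient_norm S L f0"
    using t(3) unfolding iso_profile_def iso_ratio_def less_SUP_iff by auto
  define f where "f g = \<bar>f0 g\<bar>" for g
  have [measurable]: "f0 \<in> borel_measurable borel"
    using borel_measurable_integrable[OF f0(1)] by simp
  have f[measurable]: "f \<in> borel_measurable borel" unfolding f_def[abs_def] by measurable
  have nf: "L1_norm L f = L1_norm L f0" by (simp add: L1_norm_def f_def)
  have "D f u \<le> D f0 u" for u
    unfolding D_def L1_norm_def f_def by (intro nn_integral_mono ennreal_leI) auto
  then have grad: "right_gradient_norm S L f \<le> right_gradient_norm S L f0"
    unfolding right_gradient_norm_eq by (rule SUP_mono')
  have fin: "L1_norm L f < \<infinity>"
    using f0(1) unfolding nf by (simp add: integrable_iff_bounded L1_norm_def)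
  \<comment> \<open>Clearing the denominator needs care at the ends of
    \<open>[0,\<infinity>]\<close>: a zero gradient makes the claim trivial, and an infinite one
    would make the ratio 0, against the strict inequality.\<close>
  have "ennreal t * right_gradient_norm S L f0 \<le> L1_norm L f0"
  proof (cases "right_gradient_norm S L f0 = 0 \<or> right_gradient_norm S L f0 = \<infinity>")
    case True
    then show ?thesis using f0(4) by auto
  next
    case False
    then have "ennreal t * right_gradient_norm S L f0 \<le> L1_norm L f0 / right_gradient_norm S L f0 * right_gradient_norm S L f0"
      using f0(4) by (intro mult_right_mono) auto
    also have "\<dots> = L1_norm L f0"
      using False by (simp add: ennreal_divide_times ennreal_divide_self less_top mult_divide_eq_ennreal)
    finally show ?thesis .
  qed
  with grad have le: "ennreal t * right_gradient_norm S L f \<le> L1_norm L f"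
    unfolding nf by (meson mult_left_mono order_trans zero_le)
  have Afin: "emeasure L A < \<infinity>" by (rule le_less_trans[OF A(2)]) simp
  obtain f' P where [measurable]: "f' \<in> borel_measurable borel" and f': "\<And>g. 0 \<le> f' g" "\<And>g. f' g \<le> f g"
    and d: "L1_norm L (\<lambda>g. f g - f' g) \<le> 2 * of_nat n * right_gradient_norm S L f"
    and P: "finite P" "of_nat (card P) * emeasure L (B 1) \<le> 2 * emeasure L A"
    "\<And>g. f' g \<noteq> 0 \<Longrightarrow> \<exists>p\<in>P. - p + g \<in> B 3"
    using thick_support[OF f _ A(1) Afin _ n] f0(3) by (auto simp: f_def)
  obtain N where N: "L1_norm L f = ennreal N" "0 < N"
    using ennreal_pos_finiteE f0(2) nf fin by metis
  have "ennreal t * right_gradient_norm S L f < top"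
    using le_less_trans[OF le fin] by simp
  then have "right_gradient_norm S L f < top"
    using t(2) by (auto simp: ennreal_mult_less_top)
  then obtain G where G: "right_gradient_norm S L f = ennreal G" "0 \<le> G"
    by (cases "right_gradient_norm S L f") auto
  have "ennreal (t * G) \<le> ennreal N" using le N G t(2) by (simp add: ennreal_mult)
  then have le': "t * G \<le> N" using N(2) by simp
  have "L1_norm L f' \<le> L1_norm L f"
    unfolding L1_norm_def by (intro nn_integral_mono ennreal_leI) (metis abs_of_nonneg f' order_trans)
  then have fin': "L1_norm L f' < \<infinity>" using fin by simp
  then obtain N' where N': "L1_norm L f' = ennreal N'" "0 \<le> N'"
    by (cases "L1_norm L f'") auto
  have d': "L1_norm L (\<lambda>g. f g - f' g) \<le> ennreal (2 * n * G)"
    using d G by (simp add: ennreal_mult ennreal_of_nat_eq_real_of_nat)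
  have "L1_norm L f \<le> L1_norm L (\<lambda>g. f g - f' g) + L1_norm L f'"
  proof -
    have "L1_norm L f \<le> (\<integral>\<^sup>+g. ennreal \<bar>f g - f' g\<bar> + ennreal \<bar>f' g\<bar> \<partial>L)"
      unfolding L1_norm_def
      by (intro nn_integral_mono) (auto simp flip: ennreal_plus intro!: ennreal_leI)
    then show ?thesis by (simp add: nn_integral_add L1_norm_def)
  qed
  also have "\<dots> \<le> ennreal (2 * n * G) + ennreal N'"
    using d' N' by (intro add_mono) auto
  finally have "N \<le> 2 * n * G + N'"
    using N N' G by (simp flip: ennreal_plus)
  moreover have "4 * real n * G \<le> N"
    using mult_right_mono[OF t(1) G(2)] le' by simp
  ultimately have NN': "N \<le> 2 * N'" by simp
  have "right_gradient_norm S L f' \<le> right_gradient_norm S L f + 2 * L1_norm L (\<lambda>g. f g - f' g)"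
    by (rule gradient_le_perturb) auto
  also have "\<dots> \<le> ennreal G + 2 * ennreal (2 * n * G)"
    using d' G by (intro add_mono mult_left_mono) auto
  also have "\<dots> = ennreal ((1 + 4 * n) * G)"
    using G(2) by (simp add: algebra_simps flip: ennreal_plus ennreal_numeral ennreal_mult)
  finally have "ennreal t * right_gradient_norm S L f' \<le> ennreal t * ennreal ((1 + 4 * n) * G)"
    by (intro mult_left_mono) auto
  also have "\<dots> = ennreal ((1 + 4 * n) * (t * G))"
    using t(2) G(2) by (simp add: algebra_simps flip: ennreal_mult)
  also have "\<dots> \<le> ennreal ((1 + 4 * n) * (2 * N'))"
    using le' NN' by (intro ennreal_leI mult_left_mono) auto
  also have "\<dots> = ennreal (2 * (1 + 4 * real n)) * L1_norm L f'"
    using N'(2) by (subst N'(1), subst ennreal_mult[symmetric]) (auto simp: algebra_simps)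
  finally have G': "ennreal t * right_gradient_norm S L f' \<le> ennreal (2 * (1 + 4 * real n)) * L1_norm L f'" .
  have "of_nat (card P) * emeasure L (B 1) \<le> 2 * ennreal v"
    using P(2) A(2) by (meson mult_left_mono order_trans zero_le)
  then show ?thesis
    using G' f' fin' P N N' NN' by (intro that[of f' P]) auto
qed

text \<open>The indicator of the unit ball has gradient at most twice its norm. This covers values
  of the profile of \<open>G\<close> too small for the cutting argument.\<close>

lemma iso_profile_ge_half:
  assumes "emeasure L (B 1) \<le> ennreal v"
  shows "1 \<le> 2 * iso_profile S L v"
proof -
  define f :: "'a \<Rightarrow> real" where "f = indicator (B 1)"
  have [measurable]: "f \<in> borel_measurable borel" by (simp add: f_def)
  have n: "L1_norm L f = emeasure L (B 1)"
    by (simp add: L1_norm_def f_def ennreal_indicator)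
  have w: "0 < emeasure L (B 1)" "emeasure L (B 1) < \<infinity>" using B_pos finite_B by auto
  have "right_gradient_norm S L f \<le> 2 * L1_norm L f"
    unfolding right_gradient_norm_eq by (intro SUP_least D_le_norm) auto
  then have "L1_norm L f / (2 * L1_norm L f) \<le> L1_norm L f / right_gradient_norm S L f"
    by (rule divide_left_mono_ennreal)
  also have "\<dots> \<le> iso_profile S L v"
    using assms w by (intro iso_profile_ge[of f "B 1"]) (auto simp: n, simp add: f_def)
  finally have 1: "2 * (L1_norm L f / (2 * L1_norm L f)) \<le> 2 * iso_profile S L v"
    by (rule mult_left_mono) simp
  obtain w' where "L1_norm L f = ennreal w'" "0 < w'"
    using ennreal_pos_finiteE w n by (metis less_irrefl)
  then have "2 * (L1_norm L f / (2 * L1_norm L f)) = 1"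
    by (simp add: divide_ennreal del: ennreal_half flip: ennreal_mult ennreal_numeral ennreal_1)
  with 1 show ?thesis by simp
qed

end

section \<open>Couplings\<close>

text \<open>If every \<open>z\<close> with \<open>0 < b z < \<infinity>\<close> violated the bound,
  integration would give \<open>2 * q\<close> times the integral of \<open>b\<close> below
  \<open>q\<close> times it. The factor 2 supplies the strictness that a pointwise comparison loses
  under the integral; finiteness of the integral makes the points with
  \<open>b z = \<infinity>\<close> a null set.\<close>

lemma exists_below_average:
  fixes a b :: "'z \<Rightarrow> ennreal"
  assumes [measurable]: "a \<in> borel_measurable N" "b \<in> borel_measurable N"
    and b: "integral\<^sup>N N b \<noteq> 0" "integral\<^sup>N N b < \<infinity>"
    and q: "0 < q" and le: "integral\<^sup>N N a \<le> ennreal q * integral\<^sup>N N b"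
  obtains z where "z \<in> space N" "b z \<noteq> 0" "b z < \<infinity>" "a z \<le> ennreal (2 * q) * b z"
proof (rule ccontr)
  assume neg: "\<not> thesis"
  note witness = that
  have *: "ennreal (2 * q) * b z \<le> a z" if "z \<in> space N" "b z \<noteq> \<infinity>" for z
  proof (rule ccontr)
    assume n: "\<not> ?thesis"
    then have "a z \<le> ennreal (2 * q) * b z" by (meson linear)
    then show False
      using n witness[of z] that neg by (cases "b z = 0") (auto simp: less_top)
  qed
  have "AE z in N. b z \<noteq> \<infinity>"
    by (rule nn_integral_PInf_AE) (use b in auto)
  with AE_space have AE: "AE z in N. ennreal (2 * q) * b z \<le> a z"
    by eventually_elim (rule *)
  have "ennreal (2 * q) * integral\<^sup>N N b = (\<integral>\<^sup>+z. ennreal (2 * q) * b z \<partial>N)"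
    by (simp add: nn_integral_cmult)
  also have "\<dots> \<le> integral\<^sup>N N a"
    by (rule nn_integral_mono_AE[OF AE])
  also note le
  finally have le2: "ennreal (2 * q) * integral\<^sup>N N b \<le> ennreal q * integral\<^sup>N N b" .
  obtain r where "integral\<^sup>N N b = ennreal r" "0 < r"
    using ennreal_pos_finiteE[OF b] .
  with le2 q have "2 * q * r \<le> q * r" by (simp flip: ennreal_mult)
  with q \<open>0 < r\<close> show False by simp
qed

lemma fundamental_domain_subset: "fundamental_domain act M F \<Longrightarrow> F \<subseteq> space M"
  by (auto simp: fundamental_domain_def dest: measurable_space)

locale haar_group_coupling =
  H: metric_haar_group S\<^sub>H d\<^sub>H L\<^sub>H + G: metric_haar_group S\<^sub>G d\<^sub>G L\<^sub>G
  for S\<^sub>H :: "'h::{topological_group_add, t2_space, second_countable_topology} set"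
    and S\<^sub>G :: "'g::{topological_group_add, t2_space, second_countable_topology} set"
    and d\<^sub>H d\<^sub>G L\<^sub>H L\<^sub>G +
  fixes M :: "'w measure"
    and act\<^sub>H :: "'h \<Rightarrow> 'w \<Rightarrow> 'w" and act\<^sub>G :: "'g \<Rightarrow> 'w \<Rightarrow> 'w"
    and F\<^sub>H F\<^sub>G :: "'w set" and \<nu>\<^sub>H \<nu>\<^sub>G :: "'w measure"
  assumes coupling: "measure_subgroup_coupling L\<^sub>H L\<^sub>G M act\<^sub>H act\<^sub>G F\<^sub>H F\<^sub>G \<nu>\<^sub>H \<nu>\<^sub>G"
begin

lemma F_subset: "F\<^sub>H \<subseteq> space M" "F\<^sub>G \<subseteq> space M"
  using coupling fundamental_domain_subset unfolding measure_subgroup_coupling_def by metis+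

lemma sets_\<nu>[measurable_cong]: "sets \<nu>\<^sub>H = sets (restrict_space M F\<^sub>H)" "sets \<nu>\<^sub>G = sets (restrict_space M F\<^sub>G)"
  using coupling unfolding measure_subgroup_coupling_def by metis+

lemma space_\<nu>: "space \<nu>\<^sub>H = F\<^sub>H" "space \<nu>\<^sub>G = F\<^sub>G"
  using sets_\<nu>[THEN sets_eq_imp_space_eq] F_subset by (auto simp: space_restrict_space)

sublocale \<nu>G: finite_measure \<nu>\<^sub>G
  using coupling unfolding measure_subgroup_coupling_def by metis

sublocale \<nu>H: sigma_finite_measure \<nu>\<^sub>H
  using coupling unfolding measure_subgroup_coupling_def by metis

sublocale H\<nu>: pair_sigma_finite L\<^sub>H \<nu>\<^sub>H ..
sublocale G\<nu>: pair_sigma_finite L\<^sub>G \<nu>\<^sub>G ..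

lemma measurable_\<nu>: "f \<in> measurable N \<nu>\<^sub>H \<Longrightarrow> f \<in> measurable N M"
  "f \<in> measurable N \<nu>\<^sub>G \<Longrightarrow> f \<in> measurable N M"
  using measurable_restrict_space2_iff[of f N M]
  by (auto simp: measurable_cong_sets[OF refl sets_\<nu>(1)] measurable_cong_sets[OF refl sets_\<nu>(2)])

lemma
  shows act_H_measurable': "(\<lambda>(h, x). act\<^sub>H h x) \<in> measurable (borel \<Otimes>\<^sub>M M) M"
    and act_G_measurable': "(\<lambda>(g, x). act\<^sub>G g x) \<in> measurable (borel \<Otimes>\<^sub>M M) M"
    and act_H_zero: "x \<in> space M \<Longrightarrow> act\<^sub>H 0 x = x"
    and act_H_add: "x \<in> space M \<Longrightarrow> act\<^sub>H (h + h') x = act\<^sub>H h (act\<^sub>H h' x)"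
    and act_G_zero: "x \<in> space M \<Longrightarrow> act\<^sub>G 0 x = x"
    and act_G_add: "x \<in> space M \<Longrightarrow> act\<^sub>G (g + g') x = act\<^sub>G g (act\<^sub>G g' x)"
    and act_commute: "x \<in> space M \<Longrightarrow> act\<^sub>H h (act\<^sub>G g x) = act\<^sub>G g (act\<^sub>H h x)"
    and distr_act_H: "distr M M (act\<^sub>H h) = M"
  using coupling unfolding measure_subgroup_coupling_def borel_action_def measure_preserving_action_def
  by blast+

lemma act_measurable[measurable (raw)]:
  "f \<in> measurable N borel \<Longrightarrow> k \<in> measurable N M \<Longrightarrow> (\<lambda>y. act\<^sub>H (f y) (k y)) \<in> measurable N M"
  "f' \<in> measurable N borel \<Longrightarrow> k \<in> measurable N M \<Longrightarrow> (\<lambda>y. act\<^sub>G (f' y) (k y)) \<in> measurable N M"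
  using measurable_compose[OF measurable_Pair act_H_measurable', of f N k]
    measurable_compose[OF measurable_Pair act_G_measurable', of f' N k] by simp_all

lemma act_space: "x \<in> space M \<Longrightarrow> act\<^sub>H h x \<in> space M" "x \<in> space M \<Longrightarrow> act\<^sub>G g x \<in> space M"
  using measurable_space[OF act_H_measurable', of "(h, x)"] measurable_space[OF act_G_measurable', of "(g, x)"]
  by (auto simp: space_pair_measure)

section \<open>The \<open>G\<close>-coordinate on the coupling space and the cocycle\<close>

lemma i_G_iso: "measured_space_iso (\<lambda>(g, x). act\<^sub>G g x) (L\<^sub>G \<Otimes>\<^sub>M \<nu>\<^sub>G) M"
  and i_H_iso: "measured_space_iso (\<lambda>(h, x). act\<^sub>H h x) (L\<^sub>H \<Otimes>\<^sub>M \<nu>\<^sub>H) M"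
  using coupling unfolding measure_subgroup_coupling_def by blast+

text \<open>Obtained by inverting the isomorphism, this coordinate is Borel and
  \<open>G\<close>-equivariant. The lift of \<open>f\<close> is \<open>f o \<pi>\<close>.\<close>

definition \<pi> :: "'w \<Rightarrow> 'g" where
  "\<pi> \<omega> = fst (inv_into (UNIV \<times> F\<^sub>G) (\<lambda>(g, x). act\<^sub>G g x) \<omega>)"

lemma space_G_prod: "space (L\<^sub>G \<Otimes>\<^sub>M \<nu>\<^sub>G) = UNIV \<times> F\<^sub>G"
  by (simp add: space_pair_measure space_\<nu>)

lemma i_G_bij: "bij_betw (\<lambda>(g, x). act\<^sub>G g x) (UNIV \<times> F\<^sub>G) (space M)"
  using i_G_iso by (simp add: measured_space_iso_def space_G_prod)

lemma \<pi>_measurable[measurable]: "\<pi> \<in> measurable M borel"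
proof -
  have inv: "inv_into (UNIV \<times> F\<^sub>G) (\<lambda>(g, x). act\<^sub>G g x) \<in> measurable M (L\<^sub>G \<Otimes>\<^sub>M \<nu>\<^sub>G)"
    using i_G_iso by (simp add: measured_space_iso_def space_G_prod)
  show ?thesis
    using measurable_compose[OF inv measurable_fst]
    unfolding \<pi>_def[abs_def] measurable_cong_sets[OF refl G.sets_L] .
qed

lemma i_G_inj: "x \<in> F\<^sub>G \<Longrightarrow> y \<in> F\<^sub>G \<Longrightarrow> act\<^sub>G g x = act\<^sub>G g' y \<Longrightarrow> g = g' \<and> x = y"
  using bij_betw_imp_inj_on[OF i_G_bij] by (auto simp: inj_on_def)

lemma i_G_surj:
  assumes "\<omega> \<in> space M"
  obtains g x where "x \<in> F\<^sub>G" "\<omega> = act\<^sub>G g x"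
proof -
  have "\<omega> \<in> (\<lambda>(g, x). act\<^sub>G g x) ` (UNIV \<times> F\<^sub>G)"
    using assms bij_betw_imp_surj_on[OF i_G_bij] by simp
  then show ?thesis using that by auto
qed

lemma \<pi>_act_F: "x \<in> F\<^sub>G \<Longrightarrow> \<pi> (act\<^sub>G g x) = g"
  unfolding \<pi>_def using inv_into_f_f[OF bij_betw_imp_inj_on[OF i_G_bij], of "(g, x)"] by simp

lemma \<pi>_F: "x \<in> F\<^sub>G \<Longrightarrow> \<pi> x = 0"
  using \<pi>_act_F[of x 0] F_subset by (simp add: act_G_zero subsetD)

lemma \<pi>_act:
  assumes "\<omega> \<in> space M" shows "\<pi> (act\<^sub>G g \<omega>) = g + \<pi> \<omega>"
proof -
  obtain g' x where x: "x \<in> F\<^sub>G" "\<omega> = act\<^sub>G g' x" using i_G_surj[OF assms] .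
  then have "act\<^sub>G g \<omega> = act\<^sub>G (g + g') x" using F_subset by (simp add: act_G_add subsetD)
  then show ?thesis using x by (simp add: \<pi>_act_F)
qed

text \<open>Bijectivity of \<open>(g, x) \<mapsto> g * x\<close> on
  \<open>G \<times> F\<^sub>G\<close> makes both definite descriptions meaningful. The right side is
  visibly measurable.\<close>

lemma coupling_cocycle_eq:
  assumes "x \<in> F\<^sub>G" shows "coupling_cocycle act\<^sub>H act\<^sub>G F\<^sub>G h x = \<pi> (act\<^sub>H h x)"
proof -
  have "act\<^sub>H h x \<in> space M" using assms F_subset act_space by blast
  then obtain g y where y: "y \<in> F\<^sub>G" "act\<^sub>H h x = act\<^sub>G g y" by (rule i_G_surj)
  have yM: "y \<in> space M" using y F_subset by blast
  have "induced_action act\<^sub>H act\<^sub>G F\<^sub>G h x = y"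
    unfolding induced_action_def
  proof (rule the_equality)
    have "y = act\<^sub>G (- g) (act\<^sub>H h x)"
      unfolding y(2) using yM by (simp add: act_G_zero flip: act_G_add)
    then show "y \<in> F\<^sub>G \<and> y \<in> act_orbit act\<^sub>G (act\<^sub>H h x)" using y by (auto simp: act_orbit_def)
    fix y' assume y': "y' \<in> F\<^sub>G \<and> y' \<in> act_orbit act\<^sub>G (act\<^sub>H h x)"
    then obtain g' where "y' = act\<^sub>G (g' + g) y"
      using yM by (auto simp: act_orbit_def y(2) act_G_add)
    moreover have "y' = act\<^sub>G 0 y'" using y' F_subset by (auto simp: act_G_zero)
    ultimately show "y' = y" using y' y i_G_inj by metis
  qed
  then have "coupling_cocycle act\<^sub>H act\<^sub>G F\<^sub>G h x = g"
    unfolding coupling_cocycle_def using y i_G_inj by (intro the_equality) auto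
  then show ?thesis using y by (simp add: \<pi>_act_F)
qed

section \<open>Disintegration over the two fundamental domains\<close>

lemma nn_integral_M_G:
  assumes [measurable]: "f \<in> borel_measurable M"
  shows "integral\<^sup>N M f = (\<integral>\<^sup>+x. (\<integral>\<^sup>+g. f (act\<^sub>G g x) \<partial>L\<^sub>G) \<partial>\<nu>\<^sub>G)"
proof -
  have [measurable]: "(\<lambda>(g, x). act\<^sub>G g x) \<in> measurable (L\<^sub>G \<Otimes>\<^sub>M \<nu>\<^sub>G) M"
    and eq: "distr (L\<^sub>G \<Otimes>\<^sub>M \<nu>\<^sub>G) M (\<lambda>(g, x). act\<^sub>G g x) = M"
    using i_G_iso by (auto simp: measured_space_iso_def)
  have "integral\<^sup>N M f = (\<integral>\<^sup>+p. f ((\<lambda>(g, x). act\<^sub>G g x) p) \<partial>(L\<^sub>G \<Otimes>\<^sub>M \<nu>\<^sub>G))"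
    by (subst (1) eq[symmetric], rule nn_integral_distr) auto
  also have "\<dots> = (\<integral>\<^sup>+x. (\<integral>\<^sup>+g. f ((\<lambda>(g, x). act\<^sub>G g x) (g, x)) \<partial>L\<^sub>G) \<partial>\<nu>\<^sub>G)"
    by (rule G\<nu>.nn_integral_snd[symmetric]) measurable
  finally show ?thesis by simp
qed

lemma nn_integral_M_H:
  assumes [measurable]: "f \<in> borel_measurable M"
  shows "integral\<^sup>N M f = (\<integral>\<^sup>+x. (\<integral>\<^sup>+h. f (act\<^sub>H h x) \<partial>L\<^sub>H) \<partial>\<nu>\<^sub>H)"
proof -
  have [measurable]: "(\<lambda>(h, x). act\<^sub>H h x) \<in> measurable (L\<^sub>H \<Otimes>\<^sub>M \<nu>\<^sub>H) M"
    and eq: "distr (L\<^sub>H \<Otimes>\<^sub>M \<nu>\<^sub>H) M (\<lambda>(h, x). act\<^sub>H h x) = M"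
    using i_H_iso by (auto simp: measured_space_iso_def)
  have "integral\<^sup>N M f = (\<integral>\<^sup>+p. f ((\<lambda>(h, x). act\<^sub>H h x) p) \<partial>(L\<^sub>H \<Otimes>\<^sub>M \<nu>\<^sub>H))"
    by (subst (1) eq[symmetric], rule nn_integral_distr) auto
  also have "\<dots> = (\<integral>\<^sup>+x. (\<integral>\<^sup>+h. f ((\<lambda>(h, x). act\<^sub>H h x) (h, x)) \<partial>L\<^sub>H) \<partial>\<nu>\<^sub>H)"
    by (rule H\<nu>.nn_integral_snd[symmetric]) measurable
  finally show ?thesis by simp
qed

text \<open>Zero mass would make \<open>M\<close> vanish by disintegration. The mass becomes a
  denominator in the final constant.\<close>

lemma mass_pos: "0 < measure \<nu>\<^sub>G F\<^sub>G"
proof (rule ccontr)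
  assume "\<not> ?thesis"
  then have 0: "emeasure \<nu>\<^sub>G (space \<nu>\<^sub>G) = 0"
    by (simp add: \<nu>G.emeasure_eq_measure space_\<nu> not_less measure_le_0_iff)
  have "emeasure M (space M) = (\<integral>\<^sup>+\<omega>. 1 \<partial>M)" by simp
  also have "\<dots> = 0"
    by (subst nn_integral_M_G) (auto simp: 0)
  finally show False
    using coupling by (simp add: measure_subgroup_coupling_def)
qed

section \<open>The lifted function: displacement and slices\<close>

context
  fixes f :: "'g \<Rightarrow> real"
  assumes f[measurable]: "f \<in> borel_measurable borel"
begin

text \<open>For the action of \<open>H\<close> on the lift \<open>f o \<pi>\<close>, this plays the
  role that \<open>D f\<close> plays for right translations of \<open>f\<close>.\<close>

definition E :: "'h \<Rightarrow> ennreal" where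
  "E h = (\<integral>\<^sup>+\<omega>. ennreal \<bar>f (\<pi> \<omega>) - f (\<pi> (act\<^sub>H h \<omega>))\<bar> \<partial>M)"

lemma E_zero: "E 0 = 0"
proof -
  have "E 0 = (\<integral>\<^sup>+\<omega>. 0 \<partial>M)" unfolding E_def by (intro nn_integral_cong) (simp add: act_H_zero)
  then show ?thesis by simp
qed

text \<open>The increment caused by \<open>u\<close> is taken at the point already moved by
  \<open>v\<close>; since the action preserves \<open>M\<close>, it still integrates to
  \<open>E u\<close>.\<close>

lemma E_add: "E (u + v) \<le> E u + E v"
proof -
  have "E (u + v) \<le> (\<integral>\<^sup>+\<omega>. ennreal \<bar>f (\<pi> (act\<^sub>H v \<omega>)) - f (\<pi> (act\<^sub>H u (act\<^sub>H v \<omega>)))\<bar> +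
      ennreal \<bar>f (\<pi> \<omega>) - f (\<pi> (act\<^sub>H v \<omega>))\<bar> \<partial>M)"
    unfolding E_def
    by (intro nn_integral_mono) (auto simp: act_H_add simp flip: ennreal_plus intro!: ennreal_leI)
  also have "\<dots> = (\<integral>\<^sup>+\<omega>. ennreal \<bar>f (\<pi> (act\<^sub>H v \<omega>)) - f (\<pi> (act\<^sub>H u (act\<^sub>H v \<omega>)))\<bar> \<partial>M) + E v"
    unfolding E_def by (intro nn_integral_add) measurable
  also have "(\<integral>\<^sup>+\<omega>. ennreal \<bar>f (\<pi> (act\<^sub>H v \<omega>)) - f (\<pi> (act\<^sub>H u (act\<^sub>H v \<omega>)))\<bar> \<partial>M) =
      (\<integral>\<^sup>+\<omega>. ennreal \<bar>f (\<pi> \<omega>) - f (\<pi> (act\<^sub>H u \<omega>))\<bar> \<partial>distr M M (act\<^sub>H v))"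
    by (rule nn_integral_distr[symmetric]) measurable
  finally show ?thesis by (simp add: distr_act_H E_def)
qed

text \<open>As the actions commute, \<open>\<pi> (h * (g * x)) = g + c(h, x)\<close> for
  \<open>x\<close> in \<open>F\<^sub>G\<close>, so on each \<open>G\<close>-orbit the action of
  \<open>h\<close> is a right translation by the cocycle.\<close>

lemma E_eq_cocycle: "E h = (\<integral>\<^sup>+x. G.D f (coupling_cocycle act\<^sub>H act\<^sub>G F\<^sub>G h x) \<partial>\<nu>\<^sub>G)"
proof -
  have "E h = (\<integral>\<^sup>+x. (\<integral>\<^sup>+g. ennreal \<bar>f (\<pi> (act\<^sub>G g x)) - f (\<pi> (act\<^sub>H h (act\<^sub>G g x)))\<bar> \<partial>L\<^sub>G) \<partial>\<nu>\<^sub>G)"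
    unfolding E_def by (rule nn_integral_M_G) measurable
  also have "\<dots> = (\<integral>\<^sup>+x. G.D f (coupling_cocycle act\<^sub>H act\<^sub>G F\<^sub>G h x) \<partial>\<nu>\<^sub>G)"
    unfolding G.D_def L1_norm_def
  proof (intro nn_integral_cong, goal_cases)
    case (1 x g)
    then have "x \<in> F\<^sub>G" "x \<in> space M" using F_subset by (auto simp: space_\<nu>)
    then show ?case
      by (simp add: act_commute \<pi>_act act_space coupling_cocycle_eq \<pi>_F)
  qed
  finally show ?thesis .
qed

lemma cocycle_measurable[measurable]: "coupling_cocycle act\<^sub>H act\<^sub>G F\<^sub>G h \<in> measurable \<nu>\<^sub>G borel"
proof -
  have "(\<lambda>x. \<pi> (act\<^sub>H h x)) \<in> measurable \<nu>\<^sub>G borel"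
    using measurable_\<nu>(2)[of "\<lambda>x. x" \<nu>\<^sub>G] by measurable
  then show ?thesis
    by (rule measurable_cong[THEN iffD1, rotated]) (simp add: coupling_cocycle_eq space_\<nu>)
qed

lemma norm_lift: "(\<integral>\<^sup>+\<omega>. ennreal \<bar>f (\<pi> \<omega>)\<bar> \<partial>M) = L1_norm L\<^sub>G f * ennreal (measure \<nu>\<^sub>G F\<^sub>G)"
proof -
  have "(\<integral>\<^sup>+\<omega>. ennreal \<bar>f (\<pi> \<omega>)\<bar> \<partial>M) = (\<integral>\<^sup>+x. (\<integral>\<^sup>+g. ennreal \<bar>f (\<pi> (act\<^sub>G g x))\<bar> \<partial>L\<^sub>G) \<partial>\<nu>\<^sub>G)"
    by (rule nn_integral_M_G) measurable
  also have "\<dots> = (\<integral>\<^sup>+x. L1_norm L\<^sub>G f \<partial>\<nu>\<^sub>G)"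
    unfolding L1_norm_def by (intro nn_integral_cong) (simp add: space_\<nu> \<pi>_act_F)
  finally show ?thesis by (simp add: space_\<nu> \<nu>G.emeasure_eq_measure)
qed

text \<open>The inverse makes a right translation \<open>h + u\<close> of the argument into the
  action of \<open>- u\<close> on the moved point, and agrees with the inverse in the maps
  \<open>c_x\<close> of the m-to-1 condition.\<close>

definition slice :: "'w \<Rightarrow> 'h \<Rightarrow> real" where
  "slice z h = f (\<pi> (act\<^sub>H (- h) z))"

lemma slice_measurable2[measurable]: "(\<lambda>(z, h). slice z h) \<in> borel_measurable (\<nu>\<^sub>H \<Otimes>\<^sub>M borel)"
  using measurable_\<nu>(1)[of fst "\<nu>\<^sub>H \<Otimes>\<^sub>M (borel :: 'h measure)"]
  unfolding slice_def split_beta' by measurable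

lemma slice_measurable: "z \<in> F\<^sub>H \<Longrightarrow> slice z \<in> borel_measurable borel"
  using measurable_compose[OF measurable_Pair1' slice_measurable2, of z] by (simp add: space_\<nu>)

lemma L1_norm_slice_measurable[measurable]: "(\<lambda>z. L1_norm L\<^sub>H (slice z)) \<in> borel_measurable \<nu>\<^sub>H"
  unfolding L1_norm_def by measurable

lemma D_slice_measurable[measurable]: "(\<lambda>(z, u). H.D (slice z) u) \<in> borel_measurable (\<nu>\<^sub>H \<Otimes>\<^sub>M borel)"
  unfolding H.D_def L1_norm_def split_beta' by measurable

text \<open>Inversion preserves the Haar measure of \<open>H\<close>, which removes the sign in the
  slice; the rest is disintegration over \<open>F\<^sub>H\<close>.\<close>

lemma slice_norm: "(\<integral>\<^sup>+z. L1_norm L\<^sub>H (slice z) \<partial>\<nu>\<^sub>H) = (\<integral>\<^sup>+\<omega>. ennreal \<bar>f (\<pi> \<omega>)\<bar> \<partial>M)"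
proof -
  have "L1_norm L\<^sub>H (slice z) = (\<integral>\<^sup>+h. ennreal \<bar>f (\<pi> (act\<^sub>H h z))\<bar> \<partial>L\<^sub>H)" if "z \<in> F\<^sub>H" for z
  proof -
    have "z \<in> space M" using that F_subset by auto
    then have "(\<lambda>h. ennreal \<bar>f (\<pi> (act\<^sub>H h z))\<bar>) \<in> borel_measurable borel"
      by measurable
    from H.nn_integral_uminus[OF this] show ?thesis by (simp add: L1_norm_def slice_def)
  qed
  then have "(\<integral>\<^sup>+z. L1_norm L\<^sub>H (slice z) \<partial>\<nu>\<^sub>H) = (\<integral>\<^sup>+z. (\<integral>\<^sup>+h. ennreal \<bar>f (\<pi> (act\<^sub>H h z))\<bar> \<partial>L\<^sub>H) \<partial>\<nu>\<^sub>H)"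
    by (intro nn_integral_cong) (simp add: space_\<nu>)
  also have "\<dots> = (\<integral>\<^sup>+\<omega>. ennreal \<bar>f (\<pi> \<omega>)\<bar> \<partial>M)"
    by (rule nn_integral_M_H[symmetric]) measurable
  finally show ?thesis .
qed

text \<open>Substituting \<open>- h\<close> for \<open>h\<close> and using
  \<open>- (h + u) = - u + - h\<close>, the increments of the slices become those of the lift under
  \<open>- u\<close> along the orbit of \<open>z\<close>.\<close>

lemma slice_D: "(\<integral>\<^sup>+z. H.D (slice z) u \<partial>\<nu>\<^sub>H) = E (- u)"
proof -
  have "H.D (slice z) u = (\<integral>\<^sup>+h. ennreal \<bar>f (\<pi> (act\<^sub>H h z)) - f (\<pi> (act\<^sub>H (- u) (act\<^sub>H h z)))\<bar> \<partial>L\<^sub>H)"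
    if "z \<in> F\<^sub>H" for z
  proof -
    have z: "z \<in> space M" using that F_subset by auto
    then have "(\<lambda>h. ennreal \<bar>f (\<pi> (act\<^sub>H h z)) - f (\<pi> (act\<^sub>H (- u) (act\<^sub>H h z)))\<bar>) \<in> borel_measurable borel"
      by measurable
    from H.nn_integral_uminus[OF this] show ?thesis
      using z by (simp add: L1_norm_def H.D_def slice_def minus_add act_H_add diff_conv_add_uminus
        del: add_uminus_conv_diff)
  qed
  then have "(\<integral>\<^sup>+z. H.D (slice z) u \<partial>\<nu>\<^sub>H) = (\<integral>\<^sup>+z. (\<integral>\<^sup>+h. ennreal \<bar>f (\<pi> (act\<^sub>H h z)) -
      f (\<pi> (act\<^sub>H (- u) (act\<^sub>H h z)))\<bar> \<partial>L\<^sub>H) \<partial>\<nu>\<^sub>H)"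
    by (intro nn_integral_cong) (simp add: space_\<nu>)
  also have "\<dots> = E (- u)"
    unfolding E_def by (rule nn_integral_M_H[symmetric]) measurable
  finally show ?thesis .
qed

lemma slice_D_average:
  assumes [measurable]: "W \<in> sets borel"
  shows "(\<integral>\<^sup>+z. (\<integral>\<^sup>+u. H.D (slice z) u * indicator W u \<partial>L\<^sub>H) \<partial>\<nu>\<^sub>H) = (\<integral>\<^sup>+u. E (- u) * indicator W u \<partial>L\<^sub>H)"
proof -
  have "(\<integral>\<^sup>+z. (\<integral>\<^sup>+u. H.D (slice z) u * indicator W u \<partial>L\<^sub>H) \<partial>\<nu>\<^sub>H) =
      (\<integral>\<^sup>+u. (\<integral>\<^sup>+z. H.D (slice z) u * indicator W u \<partial>\<nu>\<^sub>H) \<partial>L\<^sub>H)"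
    by (rule H\<nu>.Fubini') (simp add: split_beta')
  also have "\<dots> = (\<integral>\<^sup>+u. E (- u) * indicator W u \<partial>L\<^sub>H)"
    by (intro nn_integral_cong) (simp add: nn_integral_multc slice_D)
  finally show ?thesis .
qed

text \<open>The m-to-1 condition concerns base points in \<open>F\<^sub>G\<close>, while
  \<open>z\<close> lies in \<open>F\<^sub>H\<close>. Writing \<open>z = g0 * x\<close> with
  \<open>x\<close> in \<open>F\<^sub>G\<close> only shifts the cocycle by \<open>g0\<close> on the
  left, so the balls around \<open>P\<close> are replaced by balls of the same radius around
  \<open>- g0 + p\<close>, each costing at most \<open>m\<close> balls of \<open>H\<close>.\<close>

lemma slice_support:
  assumes z: "z \<in> F\<^sub>H" and P: "finite P" "\<And>g. f g \<noteq> 0 \<Longrightarrow> \<exists>p\<in>P. - p + g \<in> G.B 3"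
    and m: "coarsely_m_to_1 m s d\<^sub>H d\<^sub>G act\<^sub>H act\<^sub>G F\<^sub>G"
  obtains C where "finite C" "card C \<le> m * card P" "\<And>h. slice z h \<noteq> 0 \<Longrightarrow> \<exists>c\<in>C. - c + h \<in> H.B s"
proof -
  have zM: "z \<in> space M" using z F_subset by auto
  obtain g0 x where x: "x \<in> F\<^sub>G" "z = act\<^sub>G g0 x" using i_G_surj[OF zM] .
  have xM: "x \<in> space M" using x F_subset by auto
  have "\<forall>p. \<exists>C. finite C \<and> card C \<le> m \<and>
      (\<lambda>h. coupling_cocycle act\<^sub>H act\<^sub>G F\<^sub>G (- h) x) -` G.ms.mball (- g0 + p) 3 \<subseteq> (\<Union>c\<in>C. H.ms.mball c s)"
    using m x unfolding coarsely_m_to_1_def by blast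
  then obtain C where C: "\<And>p. finite (C p)" "\<And>p. card (C p) \<le> m"
    "\<And>p. (\<lambda>h. coupling_cocycle act\<^sub>H act\<^sub>G F\<^sub>G (- h) x) -` G.ms.mball (- g0 + p) 3 \<subseteq> (\<Union>c\<in>C p. H.ms.mball c s)"
    by metis
  show ?thesis
  proof (rule that)
    show "finite (\<Union>p\<in>P. C p)" using P C by auto
    have "card (\<Union>p\<in>P. C p) \<le> (\<Sum>p\<in>P. card (C p))" by (rule card_UN_le[OF P(1)])
    also have "\<dots> \<le> (\<Sum>p\<in>P. m)" by (intro sum_mono C)
    finally show "card (\<Union>p\<in>P. C p) \<le> m * card P" by (simp add: mult.commute)
    fix h assume "slice z h \<noteq> 0"
    then obtain p where p: "p \<in> P" "- p + \<pi> (act\<^sub>H (- h) z) \<in> G.B 3"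
      using P(2) by (auto simp: slice_def)
    have "\<pi> (act\<^sub>H (- h) z) = g0 + coupling_cocycle act\<^sub>H act\<^sub>G F\<^sub>G (- h) x"
      using x xM by (simp add: act_commute \<pi>_act act_space coupling_cocycle_eq)
    then have "coupling_cocycle act\<^sub>H act\<^sub>G F\<^sub>G (- h) x \<in> G.ms.mball (- g0 + p) 3"
      using p(2) unfolding G.mball_iff by (simp add: minus_add add.assoc)
    then obtain c where "c \<in> C p" "h \<in> H.ms.mball c s" using C(3)[of p] by auto
    then show "\<exists>c\<in>\<Union>p\<in>P. C p. - c + h \<in> H.B s"
      using p(1) unfolding H.mball_iff by blast
  qed
qed

end

end

section \<open>Transfer of the profile\<close>

definition sublinear_mono :: "(real \<Rightarrow> real) \<Rightarrow> bool" where
  "sublinear_mono \<phi> \<longleftrightarrow> (\<forall>t>0. 0 < \<phi> t) \<and> mono_on {0<..} \<phi> \<and> mono_on {0<..} (\<lambda>t. t / \<phi> t)"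

lemma sublinear_mono_cross:
  assumes "sublinear_mono \<phi>" "0 < r" "r \<le> t"
  shows "r * \<phi> t \<le> t * \<phi> r" "\<phi> r \<le> \<phi> t" "0 < \<phi> r"
proof -
  have p: "0 < \<phi> r" "0 < \<phi> t" using assms by (auto simp: sublinear_mono_def)
  have "r / \<phi> r \<le> t / \<phi> t"
    using assms monotone_onD[of "{0<..}" "(\<le>)" "(\<le>)" "\<lambda>t. t / \<phi> t" r t] by (auto simp: sublinear_mono_def)
  then show "r * \<phi> t \<le> t * \<phi> r" using p by (simp add: field_simps)
  show "\<phi> r \<le> \<phi> t"
    using assms monotone_onD[of "{0<..}" "(\<le>)" "(\<le>)" \<phi> r t] by (auto simp: sublinear_mono_def)
  show "0 < \<phi> r" by fact
qed

text \<open>Converts a constant loss in the argument of \<phi> into a constant factor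
  outside.\<close>

lemma sublinear_mono_scale:
  assumes "sublinear_mono \<phi>" "0 < t" "1 \<le> c"
  shows "\<phi> t \<le> c * \<phi> (t / c)"
  using sublinear_mono_cross(1)[of \<phi> "t / c" t] assms by (simp add: field_simps)

text \<open>The main estimate is available only for real \<open>t\<close> strictly below the
  profile. A finite \<open>j\<close> is reached from \<open>j / 2\<close>, which costs the factor 2;
  at \<open>j = \<infinity>\<close> monotonicity turns the limit of \<phi> into a supremum.\<close>

lemma extend_fun_le:
  assumes \<phi>: "sublinear_mono \<phi>" and le: "\<And>t. 0 < t \<Longrightarrow> ennreal t < j \<Longrightarrow> ennreal (\<phi> t) \<le> X"
  shows "extend_fun \<phi> j \<le> 2 * X"
proof (cases "j = 0 \<or> j = \<infinity>")
  case True
  show ?thesis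
  proof (cases "j = 0")
    case False
    with True have j: "j = \<infinity>" by simp
    have lim: "((\<lambda>u. ennreal (\<phi> u)) \<longlongrightarrow> (SUP u\<in>{0<..}. ennreal (\<phi> u))) at_top"
    proof (rule order_tendstoI)
      fix a assume "a < (SUP u\<in>{0<..}. ennreal (\<phi> u))"
      then obtain u where u: "0 < u" "a < ennreal (\<phi> u)" by (auto simp: less_SUP_iff)
      show "\<forall>\<^sub>F x in at_top. a < ennreal (\<phi> x)"
        using eventually_ge_at_top[of u]
        by eventually_elim (use u sublinear_mono_cross(2)[OF \<phi> u(1)] in \<open>auto intro: less_le_trans ennreal_leI\<close>)
    next
      fix a assume a: "(SUP u\<in>{0<..}. ennreal (\<phi> u)) < a"
      show "\<forall>\<^sub>F x in at_top. ennreal (\<phi> x) < a"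
        using eventually_gt_at_top[of 0]
        by eventually_elim (rule le_less_trans[OF _ a], auto intro: SUP_upper)
    qed
    have "extend_fun \<phi> j = (SUP u\<in>{0<..}. ennreal (\<phi> u))"
      using tendsto_Lim[OF _ lim] by (simp add: extend_fun_def j)
    also have "\<dots> \<le> X"
      using le by (intro SUP_least) (auto simp: j)
    also have "\<dots> \<le> 2 * X" by (simp add: mult_2)
    finally show ?thesis .
  qed (simp add: extend_fun_def)
next
  case False
  then obtain r where r: "j = ennreal r" "0 < r"
    using ennreal_pos_finiteE[of j] by (auto simp: less_top)
  have "extend_fun \<phi> j = ennreal (\<phi> r)"
    using r by (simp add: extend_fun_def)
  also have "\<dots> \<le> ennreal (2 * \<phi> (r / 2))"
    using sublinear_mono_scale[OF \<phi> r(2), of 2] by (intro ennreal_leI) simp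
  also have "\<dots> = 2 * ennreal (\<phi> (r / 2))"
    by (simp add: ennreal_mult')
  also have "\<dots> \<le> 2 * X"
    using r by (intro mult_left_mono le) (auto simp: ennreal_less_iff)
  finally show ?thesis .
qed

text \<open>Uses \<open>D f g \<le> |g| * gradient\<close> when \<open>|g| \<le> t\<close> and \<open>D f g \<le> 2 * norm\<close> otherwise.\<close>

lemma (in metric_haar_group) D_le_extend_fun:
  assumes f[measurable]: "f \<in> borel_measurable borel" and \<phi>: "sublinear_mono \<phi>" and t: "0 < t"
    and grad: "ennreal t * right_gradient_norm S L f \<le> L1_norm L f"
  shows "ennreal (\<phi> t) * D f g \<le> 2 * L1_norm L f * extend_fun \<phi> (of_nat (word_length S g))"
proof (cases "word_length S g = 0")
  \<comment> \<open>The extension of \<phi> is 0 at 0, so the left side has to vanish: length 0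
    forces \<open>g = 0\<close>, and \<open>D f 0 = 0\<close>.\<close>
  case True
  then show ?thesis using word_length_eq_0[of g] D_zero by simp
next
  case False
  define n where "n = real (word_length S g)"
  have n: "0 < n" using False by (simp add: n_def)
  have ext: "extend_fun \<phi> (of_nat (word_length S g)) = ennreal (\<phi> n)"
    using n by (simp add: extend_fun_def n_def ennreal_of_nat_eq_real_of_nat)
  show ?thesis
  proof (cases "n \<le> t")
    case True
    have "ennreal (\<phi> t) * D f g \<le> ennreal (\<phi> t) * (ennreal n * right_gradient_norm S L f)"
      using D_le_word_length[OF f, of g]
      by (intro mult_left_mono) (simp_all add: n_def ennreal_of_nat_eq_real_of_nat)
    also have "\<dots> = ennreal (n * \<phi> t) * right_gradient_norm S L f"
      using n sublinear_mono_cross(3)[OF \<phi> t order_refl] by (simp add: ennreal_mult mult_ac)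
    \<comment> \<open>Cross-multiplied form of \<open>n / \<phi> n \<le> t / \<phi> t\<close>; the
      other case uses that \<phi> itself is non-decreasing.\<close>
    also have "\<dots> \<le> ennreal (t * \<phi> n) * right_gradient_norm S L f"
      using sublinear_mono_cross(1)[OF \<phi> n True] by (intro mult_right_mono ennreal_leI) auto
    also have "\<dots> = ennreal (\<phi> n) * (ennreal t * right_gradient_norm S L f)"
      using t sublinear_mono_cross(3)[OF \<phi> n order_refl] by (simp add: ennreal_mult mult_ac)
    also have "\<dots> \<le> ennreal (\<phi> n) * L1_norm L f"
      using grad by (intro mult_left_mono) auto
    also have "\<dots> \<le> ennreal (\<phi> n) * (2 * L1_norm L f)"
      by (intro mult_left_mono) (simp_all add: mult_2)
    finally show ?thesis by (simp add: ext mult_ac)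
  next
    case False
    then have "\<phi> t \<le> \<phi> n" using sublinear_mono_cross(2)[OF \<phi> t] by simp
    then have "ennreal (\<phi> t) * D f g \<le> ennreal (\<phi> n) * (2 * L1_norm L f)"
      using D_le_norm[OF f] by (intro mult_mono ennreal_leI) auto
    then show ?thesis by (simp add: ext mult_ac)
  qed
qed

context haar_group_coupling
begin

text \<open>Integrate the interpolation inequality for \<open>D f\<close> at the cocycle over
  \<open>F\<^sub>G\<close>.\<close>

lemma E_bound:
  assumes f[measurable]: "f \<in> borel_measurable borel" and fin: "L1_norm L\<^sub>G f \<noteq> 0" "L1_norm L\<^sub>G f < \<infinity>"
    and \<phi>: "sublinear_mono \<phi>" and t: "0 < t"
    and grad: "ennreal t * right_gradient_norm S\<^sub>G L\<^sub>G f \<le> L1_norm L\<^sub>G f"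
    and k: "(\<integral>\<^sup>+x. extend_fun \<phi> (of_nat (word_length S\<^sub>G (coupling_cocycle act\<^sub>H act\<^sub>G F\<^sub>G h x))) \<partial>\<nu>\<^sub>G) \<le> ennreal k"
  shows "ennreal (\<phi> t) * E f h \<le> 2 * L1_norm L\<^sub>G f * ennreal k"
proof -
  let ?c = "coupling_cocycle act\<^sub>H act\<^sub>G F\<^sub>G h"
  obtain N where N: "L1_norm L\<^sub>G f = ennreal N" "0 < N" using ennreal_pos_finiteE[OF fin] .
  have inv: "ennreal (1 / (2 * N)) * (2 * ennreal N) = 1"
  proof -
    have "2 * ennreal N = ennreal (2 * N)" by (simp add: ennreal_mult')
    moreover have "ennreal (1 / (2 * N)) * ennreal (2 * N) = ennreal (1 / (2 * N) * (2 * N))"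
      using N by (intro ennreal_mult[symmetric]) auto
    ultimately show ?thesis using N by simp
  qed
  note [measurable] = cocycle_measurable[OF f]
  \<comment> \<open>The factor \<open>2 * N\<close> is divided out before integrating: constants are
    then pulled only out of integrals of \<open>G.D f\<close> along the cocycle, whose measurability
    is known, and the word length integrand is merely compared.\<close>
  have "ennreal (1 / (2 * N)) * (ennreal (\<phi> t) * E f h) =
      (\<integral>\<^sup>+x. ennreal (1 / (2 * N)) * (ennreal (\<phi> t) * G.D f (?c x)) \<partial>\<nu>\<^sub>G)"
    by (simp add: E_eq_cocycle[OF f] nn_integral_cmult)
  also have "\<dots> \<le> (\<integral>\<^sup>+x. extend_fun \<phi> (of_nat (word_length S\<^sub>G (?c x))) \<partial>\<nu>\<^sub>G)"
  proof (intro nn_integral_mono)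
    fix x
    have "ennreal (1 / (2 * N)) * (ennreal (\<phi> t) * G.D f (?c x)) \<le>
        ennreal (1 / (2 * N)) * (2 * ennreal N * extend_fun \<phi> (of_nat (word_length S\<^sub>G (?c x))))"
      using G.D_le_extend_fun[OF f \<phi> t grad] by (intro mult_left_mono) (simp_all add: N)
    then show "ennreal (1 / (2 * N)) * (ennreal (\<phi> t) * G.D f (?c x)) \<le> extend_fun \<phi> (of_nat (word_length S\<^sub>G (?c x)))"
      unfolding mult.assoc[symmetric, of _ "2 * ennreal N"] inv by simp
  qed
  also note k
  finally have "2 * ennreal N * (ennreal (1 / (2 * N)) * (ennreal (\<phi> t) * E f h)) \<le> 2 * ennreal N * ennreal k"
    by (rule mult_left_mono) simp
  then show ?thesis
    unfolding mult.assoc[symmetric, of "2 * ennreal N"] mult.commute[of "2 * ennreal N" "ennreal (1 / (2 * N))"] inv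
    by (simp add: N)
qed

text \<open>The averaged displacement bound and the norm of the lift are both proportional to the
  norm of \<open>f\<close>, which cancels. The resulting constant depends neither on
  \<open>f\<close> nor on \<open>t\<close>, so it is uniform in the volume.\<close>

lemma profile_transfer:
  assumes f[measurable]: "f \<in> borel_measurable borel" and f0: "\<And>g. 0 \<le> f g"
    and fin: "L1_norm L\<^sub>G f \<noteq> 0" "L1_norm L\<^sub>G f < \<infinity>"
    and \<phi>: "sublinear_mono \<phi>" and t: "0 < t"
    and grad: "ennreal t * right_gradient_norm S\<^sub>G L\<^sub>G f \<le> L1_norm L\<^sub>G f"
    and P: "finite P" "\<And>g. f g \<noteq> 0 \<Longrightarrow> \<exists>p\<in>P. - p + g \<in> G.B 3"
    and m: "coarsely_m_to_1 m s d\<^sub>H d\<^sub>G act\<^sub>H act\<^sub>G F\<^sub>G"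
    and k: "0 < k" "\<And>h. h \<in> S\<^sub>H \<Longrightarrow>
      (\<integral>\<^sup>+x. extend_fun \<phi> (of_nat (word_length S\<^sub>G (coupling_cocycle act\<^sub>H act\<^sub>G F\<^sub>G h x))) \<partial>\<nu>\<^sub>G) \<le> ennreal k"
    and R: "S\<^sub>H \<subseteq> H.B R" "0 < R"
    and n: "0 < n" "\<And>u. u \<in> H.B (R + 1) \<Longrightarrow> word_length S\<^sub>H u \<le> n"
    and v: "of_nat (m * card P) * emeasure L\<^sub>H (H.B (s + 1)) \<le> ennreal v"
  shows
    "ennreal (\<phi> t) \<le> ennreal (4 * real n * k * measure L\<^sub>H (H.B (R + 1)) / (measure L\<^sub>H (H.B 1) * measure \<nu>\<^sub>G F\<^sub>G)) *
      iso_profile S\<^sub>H L\<^sub>H v"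
proof -
  obtain N where N: "L1_norm L\<^sub>G f = ennreal N" "0 < N" using ennreal_pos_finiteE[OF fin] .
  have \<phi>t: "0 < \<phi> t" using sublinear_mono_cross(3)[OF \<phi> t order_refl] .
  define b where "b = measure \<nu>\<^sub>G F\<^sub>G"
  have b: "0 < b" using mass_pos by (simp add: b_def)
  define w where "w = measure L\<^sub>H (H.B 1)"
  have w: "emeasure L\<^sub>H (H.B 1) = ennreal w" "0 < w"
    using H.B_pos[of 1] H.finite_B[of 1] by (auto simp: w_def emeasure_eq_ennreal_measure less_top)
  define l where "l = measure L\<^sub>H (H.B (R + 1))"
  have l: "emeasure L\<^sub>H (H.B (R + 1)) = ennreal l" "0 < l"
    using H.B_pos[of "R + 1"] H.finite_B[of "R + 1"] R by (auto simp: l_def emeasure_eq_ennreal_measure less_top)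
  \<comment> \<open>A generator displaces the lift by at most \<open>2 * N * k / \<phi> t\<close>, a
    point of \<open>B (R + 1)\<close> by \<open>n\<close> times that; integration over this ball
    contributes \<open>l\<close>, and dividing by the norm \<open>N * b\<close> of the lift gives
    \<open>q\<close>.\<close>
  define q where "q = 2 * real n * k * l / (\<phi> t * b)"
  have q: "0 < q" using n k l b \<phi>t by (simp add: q_def)
  have norm: "(\<integral>\<^sup>+z. L1_norm L\<^sub>H (slice f z) \<partial>\<nu>\<^sub>H) = ennreal (N * b)"
    using N b by (simp add: slice_norm[OF f] norm_lift[OF f] b_def ennreal_mult)
  have E_le: "E f (- u) \<le> ennreal (2 * real n * k * N / \<phi> t)" if "u \<in> H.B (R + 1)" for u
  proof -
    have gen: "E f h \<le> ennreal (2 * N * k / \<phi> t)" if "h \<in> S\<^sub>H" for h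
    proof -
      have "ennreal (\<phi> t) * E f h \<le> ennreal (2 * N * k)"
        using E_bound[OF f fin \<phi> t grad k(2)[OF that]] N k by (simp add: ennreal_mult)
      then have "ennreal (1 / \<phi> t) * (ennreal (\<phi> t) * E f h) \<le> ennreal (1 / \<phi> t) * ennreal (2 * N * k)"
        by (rule mult_left_mono) simp
      moreover have "ennreal (1 / \<phi> t) * ennreal (\<phi> t) = 1"
        using \<phi>t by (simp flip: ennreal_mult)
      moreover have "ennreal (1 / \<phi> t) * ennreal (2 * N * k) = ennreal (2 * N * k / \<phi> t)"
        using \<phi>t N k by (subst ennreal_mult[symmetric]) auto
      ultimately show ?thesis by (simp flip: mult.assoc)
    qed
    have "E f (- u) \<le> of_nat (word_length S\<^sub>H (- u)) * ennreal (2 * N * k / \<phi> t)"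
      by (rule H.subadditive_le_word_length[OF E_zero[OF f] E_add[OF f] gen])
    also have "\<dots> \<le> of_nat n * ennreal (2 * N * k / \<phi> t)"
      using n(2)[of "- u"] that by (intro mult_right_mono) (auto simp: H.B_uminus)
    also have "\<dots> = ennreal (2 * real n * k * N / \<phi> t)"
      using N k \<phi>t by (simp add: ennreal_of_nat_eq_real_of_nat mult_ac flip: ennreal_mult)
    finally show ?thesis .
  qed
  have "(\<integral>\<^sup>+z. (\<integral>\<^sup>+u. H.D (slice f z) u * indicator (H.B (R + 1)) u \<partial>L\<^sub>H) \<partial>\<nu>\<^sub>H) =
      (\<integral>\<^sup>+u. E f (- u) * indicator (H.B (R + 1)) u \<partial>L\<^sub>H)"
    by (rule slice_D_average[OF f]) simp
  also have "\<dots> \<le> (\<integral>\<^sup>+u. ennreal (2 * real n * k * N / \<phi> t) * indicator (H.B (R + 1)) u \<partial>L\<^sub>H)"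
    using E_le by (intro nn_integral_mono) (auto simp: indicator_def)
  also have "\<dots> = ennreal (2 * real n * k * N / \<phi> t) * ennreal l"
    by (simp add: nn_integral_cmult l)
  also have "\<dots> = ennreal q * ennreal (N * b)"
    using N k \<phi>t l b q by (simp add: q_def flip: ennreal_mult)
  finally have avg: "(\<integral>\<^sup>+z. (\<integral>\<^sup>+u. H.D (slice f z) u * indicator (H.B (R + 1)) u \<partial>L\<^sub>H) \<partial>\<nu>\<^sub>H) \<le>
      ennreal q * (\<integral>\<^sup>+z. L1_norm L\<^sub>H (slice f z) \<partial>\<nu>\<^sub>H)"
    by (simp add: norm)
  note [measurable] = D_slice_measurable[OF f] L1_norm_slice_measurable[OF f]
  obtain z where z: "z \<in> space \<nu>\<^sub>H" "L1_norm L\<^sub>H (slice f z) \<noteq> 0" "L1_norm L\<^sub>H (slice f z) < \<infinity>"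
    "(\<integral>\<^sup>+u. H.D (slice f z) u * indicator (H.B (R + 1)) u \<partial>L\<^sub>H) \<le> ennreal (2 * q) * L1_norm L\<^sub>H (slice f z)"
    by (rule exists_below_average[OF _ _ _ _ q avg]) (use N b in \<open>auto simp: norm\<close>)
  have zF: "z \<in> F\<^sub>H" using z(1) by (simp add: space_\<nu>)
  obtain C where C: "finite C" "card C \<le> m * card P" "\<And>h. slice f z h \<noteq> 0 \<Longrightarrow> \<exists>c\<in>C. - c + h \<in> H.B s"
    using slice_support[OF f zF P m] by blast
  have "of_nat (card C) * emeasure L\<^sub>H (H.B (s + 1)) \<le> of_nat (m * card P) * emeasure L\<^sub>H (H.B (s + 1))"
    using C(2) by (intro mult_right_mono of_nat_mono) auto
  also note v
  finally have "emeasure L\<^sub>H (H.B 1) \<le> ennreal (2 * q) * iso_profile S\<^sub>H L\<^sub>H v"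
    using H.iso_profile_ge_averaged[OF slice_measurable[OF f zF] _ z(2,3) R _ z(4) C(1,3)] q
    by (simp add: slice_def[OF f] f0)
  then have "ennreal (\<phi> t / w) * ennreal w \<le> ennreal (\<phi> t / w) * (ennreal (2 * q) * iso_profile S\<^sub>H L\<^sub>H v)"
    unfolding w(1) by (rule mult_left_mono) simp
  also have "\<dots> = ennreal (\<phi> t / w * (2 * q)) * iso_profile S\<^sub>H L\<^sub>H v"
    using w q \<phi>t by (subst ennreal_mult) (auto simp: mult.assoc)
  also have "\<phi> t / w * (2 * q) = 4 * real n * k * l / (w * b)"
    using \<phi>t w b by (simp add: q_def field_simps)
  also have "ennreal (\<phi> t / w) * ennreal w = ennreal (\<phi> t)"
    using w \<phi>t by (simp flip: ennreal_mult)
  finally show ?thesis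
    by (simp add: l_def w_def b_def)
qed

lemma profile_bound:
  assumes \<phi>: "sublinear_mono \<phi>" and m: "coarsely_m_to_1 m s d\<^sub>H d\<^sub>G act\<^sub>H act\<^sub>G F\<^sub>G" "0 < m" "0 < s"
    and int: "phi_integrable_coupling \<phi> S\<^sub>H S\<^sub>G act\<^sub>H act\<^sub>G F\<^sub>G \<nu>\<^sub>G"
  shows "asymp_preceq (\<lambda>v. extend_fun \<phi> (iso_profile S\<^sub>G L\<^sub>G v)) (iso_profile S\<^sub>H L\<^sub>H)"
proof -
  define I where "I = (SUP h\<in>S\<^sub>H. \<integral>\<^sup>+x. extend_fun \<phi> (of_nat (word_length S\<^sub>G (coupling_cocycle act\<^sub>H act\<^sub>G F\<^sub>G h x))) \<partial>\<nu>\<^sub>G)"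
  have I: "I < \<infinity>" using int by (simp add: phi_integrable_coupling_def I_def)
  \<comment> \<open>The supremum may be 0; adding 1 keeps \<open>k\<close> positive.\<close>
  define k where "k = enn2real I + 1"
  have k: "0 < k" by (simp add: k_def add_nonneg_pos)
  have "I = ennreal (enn2real I)" using I by simp
  then have Ik: "I \<le> ennreal k" unfolding k_def by (metis ennreal_leI less_add_one less_imp_le)
  have k2: "(\<integral>\<^sup>+x. extend_fun \<phi> (of_nat (word_length S\<^sub>G (coupling_cocycle act\<^sub>H act\<^sub>G F\<^sub>G h x))) \<partial>\<nu>\<^sub>G) \<le> ennreal k"
    if "h \<in> S\<^sub>H" for h
    by (rule order_trans[OF SUP_upper[OF that] Ik[unfolded I_def]])
  obtain R where R: "S\<^sub>H \<subseteq> H.B R" "0 < R" using H.generators_bounded by blast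
  obtain n where n: "0 < n" "\<And>u. u \<in> H.B (R + 1) \<Longrightarrow> word_length S\<^sub>H u \<le> n"
    using H.word_length_bounded by blast
  obtain n' where n': "0 < n'" "\<And>u. u \<in> G.B 1 \<Longrightarrow> word_length S\<^sub>G u \<le> n'"
    using G.word_length_bounded by blast
  define c where "c = 2 * (1 + 4 * real n')"
  have c: "1 \<le> c" by (simp add: c_def)
  define w where "w = measure L\<^sub>H (H.B 1)"
  have w: "emeasure L\<^sub>H (H.B 1) = ennreal w" "0 < w"
    using H.B_pos[of 1] H.finite_B[of 1] by (auto simp: w_def emeasure_eq_ennreal_measure less_top)
  define wG where "wG = measure L\<^sub>G (G.B 1)"
  have wG: "emeasure L\<^sub>G (G.B 1) = ennreal wG" "0 < wG"
    using G.B_pos[of 1] G.finite_B[of 1] by (auto simp: wG_def emeasure_eq_ennreal_measure less_top)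
  define l where "l = measure L\<^sub>H (H.B (s + 1))"
  have l: "emeasure L\<^sub>H (H.B (s + 1)) = ennreal l" "0 < l"
    using H.B_pos[of "s + 1"] H.finite_B[of "s + 1"] m by (auto simp: l_def emeasure_eq_ennreal_measure less_top)
  \<comment> \<open>At most \<open>2 * v / wG\<close> balls cover the support in \<open>G\<close>,
    each gives at most \<open>m\<close> balls in \<open>H\<close>, and after smoothing each of those
    has volume \<open>l\<close>.\<close>
  define C where "C = 2 * m * l / wG"
  have C: "0 < C" using m l wG by (simp add: C_def)
  define q where "q = 4 * real n * k * measure L\<^sub>H (H.B (R + 1)) / (w * measure \<nu>\<^sub>G F\<^sub>G)"
  have q0: "0 \<le> q" using k w mass_pos by (simp add: q_def)
  \<comment> \<open>The threshold from which cutting down the support keeps half of the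
    norm.\<close>
  define t0 where "t0 = 4 * real n'"
  have t0: "0 < t0" using n' by (simp add: t0_def)
  \<comment> \<open>One summand for each case of \<open>main\<close>: \<open>c * q\<close> above the
    threshold \<open>t0\<close> and \<open>2 * \<phi> t0\<close> below it.\<close>
  define K where "K = c * q + 2 * \<phi> t0"
  have K: "0 < K" using c q0 sublinear_mono_cross(3)[OF \<phi> t0 order_refl] by (simp add: K_def add_nonneg_pos)
  have main: "ennreal (\<phi> t) \<le> ennreal K * iso_profile S\<^sub>H L\<^sub>H (C * v)"
    if t: "0 < t" "ennreal t < iso_profile S\<^sub>G L\<^sub>G v" and v: "0 < v" "w \<le> C * v" for t v
  proof (cases "t0 \<le> t")
    case True
    obtain f P where f: "f \<in> borel_measurable borel" "\<And>g. 0 \<le> f g" "L1_norm L\<^sub>G f \<noteq> 0" "L1_norm L\<^sub>G f < \<infinity>"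
      "ennreal t * right_gradient_norm S\<^sub>G L\<^sub>G f \<le> ennreal c * L1_norm L\<^sub>G f"
      "finite P" "of_nat (card P) * emeasure L\<^sub>G (G.B 1) \<le> 2 * ennreal v"
      "\<And>g. f g \<noteq> 0 \<Longrightarrow> \<exists>p\<in>P. - p + g \<in> G.B 3"
      by (rule G.almost_optimal_function[OF n'(2) True[unfolded t0_def] t, folded c_def])
        (assumption, rule that, auto)
    have "ennreal (1 / c) * (ennreal t * right_gradient_norm S\<^sub>G L\<^sub>G f) \<le> ennreal (1 / c) * (ennreal c * L1_norm L\<^sub>G f)"
      by (rule mult_left_mono[OF f(5)]) simp
    moreover have "ennreal (1 / c) * ennreal c = 1" using c by (simp flip: ennreal_mult)
    moreover have "ennreal (1 / c) * ennreal t = ennreal (t / c)" using c t by (simp flip: ennreal_mult)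
    ultimately have grad: "ennreal (t / c) * right_gradient_norm S\<^sub>G L\<^sub>G f \<le> L1_norm L\<^sub>G f"
      by (simp flip: mult.assoc)
    have "ennreal (card P * wG) \<le> ennreal (2 * v)"
      using f(7) v by (simp add: wG ennreal_mult' ennreal_of_nat_eq_real_of_nat)
    then have "card P * wG \<le> 2 * v" using v by simp
    then have "m * card P * l \<le> C * v"
      using wG l mult_left_mono[of "card P * wG" "2 * v" "m * l"] by (simp add: C_def field_simps)
    then have V: "of_nat (m * card P) * emeasure L\<^sub>H (H.B (s + 1)) \<le> ennreal (C * v)"
      using l by (simp add: ennreal_of_nat_eq_real_of_nat ennreal_leI flip: ennreal_mult of_nat_mult)
    \<comment> \<open>The function obtained after cutting has ratio at least \<open>t / c\<close>
      only, so the transfer is applied at \<open>t / c\<close> and the loss is moved outside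
      \<phi>.\<close>
    have "ennreal (\<phi> t) \<le> ennreal (c * \<phi> (t / c))"
      by (rule ennreal_leI[OF sublinear_mono_scale[OF \<phi> t(1) c]])
    also have "\<dots> = ennreal c * ennreal (\<phi> (t / c))"
      using c by (simp add: ennreal_mult')
    also have "\<dots> \<le> ennreal c * (ennreal q * iso_profile S\<^sub>H L\<^sub>H (C * v))"
      unfolding q_def w_def using t c
      by (intro mult_left_mono profile_transfer[OF f(1-4) \<phi> _ grad f(6,8) m(1) k k2 R n V]) auto
    also have "\<dots> = ennreal (c * q) * iso_profile S\<^sub>H L\<^sub>H (C * v)"
      using c q0 by (simp add: ennreal_mult mult.assoc)
    also have "\<dots> \<le> ennreal K * iso_profile S\<^sub>H L\<^sub>H (C * v)"
      using sublinear_mono_cross(3)[OF \<phi> t0 order_refl] by (intro mult_right_mono ennreal_leI) (auto simp: K_def)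
    finally show ?thesis .
  next
    case False
    have "ennreal (\<phi> t) \<le> ennreal (\<phi> t0) * 1"
      using sublinear_mono_cross(2)[OF \<phi> t(1), of t0] False by (simp add: ennreal_leI)
    also have "\<dots> \<le> ennreal (\<phi> t0) * (2 * iso_profile S\<^sub>H L\<^sub>H (C * v))"
      using v by (intro mult_left_mono H.iso_profile_ge_half) (auto simp: w ennreal_leI)
    also have "\<dots> = ennreal (2 * \<phi> t0) * iso_profile S\<^sub>H L\<^sub>H (C * v)"
      by (subst ennreal_mult') (simp_all add: mult_ac)
    also have "\<dots> \<le> ennreal K * iso_profile S\<^sub>H L\<^sub>H (C * v)"
      using c q0 by (intro mult_right_mono ennreal_leI) (auto simp: K_def)
    finally show ?thesis .
  qed
  \<comment> \<open>Taking \<open>v \<ge> w / C\<close> makes room for the unit ball of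
    \<open>H\<close> in volume \<open>C * v\<close>, as the lower bound 1/2 for its profile
    requires.\<close>
  have "\<forall>\<^sub>F v in at_top. extend_fun \<phi> (iso_profile S\<^sub>G L\<^sub>G v) \<le> ennreal (2 * K) * iso_profile S\<^sub>H L\<^sub>H (C * v)"
    using eventually_gt_at_top[of 0] eventually_ge_at_top[of "w / C"]
  proof eventually_elim
    case (elim v)
    then have "w \<le> C * v" using C by (simp add: field_simps)
    then have "extend_fun \<phi> (iso_profile S\<^sub>G L\<^sub>G v) \<le> 2 * (ennreal K * iso_profile S\<^sub>H L\<^sub>H (C * v))"
      using elim by (intro extend_fun_le[OF \<phi>] main)
    then show ?case by (simp add: ennreal_mult' mult.assoc)
  qed
  then show ?thesis
    unfolding asymp_preceq_def using C K by (intro exI[of _ C] conjI exI[of _ "2 * K"]) auto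
qed

end

theorem theorem3:
  fixes S\<^sub>H :: "'h::{topological_group_add, t2_space, second_countable_topology} set"
    and S\<^sub>G :: "'g::{topological_group_add, t2_space, second_countable_topology} set"
    and d\<^sub>H :: "'h \<Rightarrow> 'h \<Rightarrow> real" and d\<^sub>G :: "'g \<Rightarrow> 'g \<Rightarrow> real"
    and L\<^sub>H :: "'h measure" and L\<^sub>G :: "'g measure"
    and s :: real and m :: nat and \<phi> :: "real \<Rightarrow> real"
    and M :: "'w measure"
    and act\<^sub>H :: "'h \<Rightarrow> 'w \<Rightarrow> 'w" and act\<^sub>G :: "'g \<Rightarrow> 'w \<Rightarrow> 'w"
    and F\<^sub>H F\<^sub>G :: "'w set" and \<nu>\<^sub>H \<nu>\<^sub>G :: "'w measure"
  assumes "locally_compact_space (euclidean :: 'h topology)"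
    and "locally_compact_space (euclidean :: 'g topology)"
    and "compact_symmetric_generating S\<^sub>H" and "compact_symmetric_generating S\<^sub>G"
    and "unimodular TYPE('h)" and "unimodular TYPE('g)"
    and "admissible_metric S\<^sub>H d\<^sub>H" and "admissible_metric S\<^sub>G d\<^sub>G"
    and "left_haar_measure L\<^sub>H" and "left_haar_measure L\<^sub>G"
    and "s > 0"
    and "\<And>t. t > 0 \<Longrightarrow> \<phi> t > 0"
    and "mono_on {0<..} \<phi>" and "mono_on {0<..} (\<lambda>t. t / \<phi> t)"
    and "measure_subgroup_coupling L\<^sub>H L\<^sub>G M act\<^sub>H act\<^sub>G F\<^sub>H F\<^sub>G \<nu>\<^sub>H \<nu>\<^sub>G"
    and "phi_integrable_coupling \<phi> S\<^sub>H S\<^sub>G act\<^sub>H act\<^sub>G F\<^sub>G \<nu>\<^sub>G"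
    and "m > 0"
    and "coarsely_m_to_1 m s d\<^sub>H d\<^sub>G act\<^sub>H act\<^sub>G F\<^sub>G"
  shows "asymp_preceq (\<lambda>v. extend_fun \<phi> (iso_profile S\<^sub>G L\<^sub>G v)) (iso_profile S\<^sub>H L\<^sub>H)"
proof -
  interpret haar_group_coupling S\<^sub>H S\<^sub>G d\<^sub>H d\<^sub>G L\<^sub>H L\<^sub>G M act\<^sub>H act\<^sub>G F\<^sub>H F\<^sub>G \<nu>\<^sub>H \<nu>\<^sub>G
    by unfold_locales fact+
  have "sublinear_mono \<phi>"
    using assms(12-14) by (simp add: sublinear_mono_def)
  from profile_bound[OF this assms(18,17,11,16)] show ?thesis .
qed

end
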